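(* For an integer $a\geq 1$, let $K(a)$ (respectively $N(a)$) be the largest dimension (respectively the largest length) of a projective $[n,k]_2$ three-weight code $C$ with non-zero weights $w_1<w_2<w_3$ satisfying $w_1+w_2+w_3=\tfrac{3n}{2}$ and $w_2=\tfrac{n}{2}$ such that $C$ is not $2^a$-divisible. Then: (a) $K(1)=3$ and $N(1)=4$; (b) $K(2)=6$ and $N(2)=56$; (c) $K(3)=11$ and $N(3)=2024$.
   Context: An $[n,k]_2$ code is a $k$-dimensional linear subspace $C$ of $\mathbb{F}_2^n$; $n$ is its length and $k$ its dimension; the weight of a codeword is its number of non-zero entries. The code is full-length if for no coordinate position all codewords vanish at that position. A binary code is projective if it is full-length and no two distinct coordinate positions $i\neq j$ satisfy $c_i=c_j$ for all $c\in C$. A three-weight code is a linear code having exactly three different non-zero weights. A code is $\Delta$-divisible (for an integer $\Delta\geq1$) if all its weights are divisible by $\Delta$. The maxima $K(a)$ and $N(a)$ are each taken over all codes of the described kind, of any length $n$ and dimension $k$ (the two maxima are taken independently); they exist. *)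

theory Defs
  imports Complex_Main "HOL-Library.Z2" "HOL-Library.Function_Algebras"
begin

text \<open>
  Since the length \<open>n\<close> varies inside the statement, the space $\mathbb{F}_2^n$ is represented by the
  functions \<open>nat \<Rightarrow> bit\<close> that vanish outside the coordinate positions \<open>0, \<dots>, n - 1\<close>, with
  pointwise addition and scalar multiplication.  Subspaces and dimension are the library notions for
  the vector space \<open>nat \<Rightarrow> bit\<close> over \<open>bit\<close>.
\<close>

definition word_scale :: "bit \<Rightarrow> (nat \<Rightarrow> bit) \<Rightarrow> (nat \<Rightarrow> bit)" where
  "word_scale b c = (\<lambda>i. b * c i)"

global_interpretation word: vector_space word_scale
  defines word_subspace = word.subspace
    and word_span = word.span
    and word_dependent = word.dependent
    and word_dim = word.dim
  by standard (auto simp: word_scale_def fun_eq_iff distrib_left distrib_right mult.assoc)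

definition word_space :: "nat \<Rightarrow> (nat \<Rightarrow> bit) set" where
  "word_space n = {c. \<forall>i\<ge>n. c i = 0}"

definition linear_code :: "nat \<Rightarrow> nat \<Rightarrow> (nat \<Rightarrow> bit) set \<Rightarrow> bool" where
  "linear_code n k C \<longleftrightarrow> C \<subseteq> word_space n \<and> word.subspace C \<and> word.dim C = k"

definition weight :: "nat \<Rightarrow> (nat \<Rightarrow> bit) \<Rightarrow> nat" where
  "weight n c = card {i. i < n \<and> c i \<noteq> 0}"

definition full_length :: "nat \<Rightarrow> (nat \<Rightarrow> bit) set \<Rightarrow> bool" where
  "full_length n C \<longleftrightarrow> \<not> (\<exists>i<n. \<forall>c\<in>C. c i = 0)"

definition projective :: "nat \<Rightarrow> (nat \<Rightarrow> bit) set \<Rightarrow> bool" where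
  "projective n C \<longleftrightarrow>
     full_length n C \<and> \<not> (\<exists>i<n. \<exists>j<n. i \<noteq> j \<and> (\<forall>c\<in>C. c i = c j))"

definition nonzero_weights :: "nat \<Rightarrow> (nat \<Rightarrow> bit) set \<Rightarrow> nat set" where
  "nonzero_weights n C = {w. w \<noteq> 0 \<and> (\<exists>c\<in>C. weight n c = w)}"

definition divisible_code :: "nat \<Rightarrow> nat \<Rightarrow> (nat \<Rightarrow> bit) set \<Rightarrow> bool" where
  "divisible_code d n C \<longleftrightarrow> (\<forall>c\<in>C. d dvd weight n c)"

text \<open>
  The three-weight condition is the equation \<open>nonzero_weights n C = {w1, w2, w3}\<close> with
  \<open>w1 < w2 < w3\<close>.
\<close>

definition admissible_code :: "nat \<Rightarrow> nat \<Rightarrow> nat \<Rightarrow> (nat \<Rightarrow> bit) set \<Rightarrow> bool" where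
  "admissible_code a n k C \<longleftrightarrow>
     linear_code n k C \<and> projective n C \<and>
     (\<exists>w1 w2 w3. w1 < w2 \<and> w2 < w3 \<and> nonzero_weights n C = {w1, w2, w3} \<and>
        real w1 + real w2 + real w3 = 3 * real n / 2 \<and> real w2 = real n / 2) \<and>
     \<not> divisible_code (2 ^ a) n C"

definition is_maximum :: "nat set \<Rightarrow> nat \<Rightarrow> bool" where
  "is_maximum S m \<longleftrightarrow> m \<in> S \<and> (\<forall>x\<in>S. x \<le> m)"

text \<open>
  \<open>is_K a m\<close> and \<open>is_N a m\<close> say that the maximum $K(a)$, respectively $N(a)$, exists and equals \<open>m\<close>.
  As relations they avoid an unspecified value should a maximum fail to exist.
\<close>

definition is_K :: "nat \<Rightarrow> nat \<Rightarrow> bool" where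
  "is_K a m \<longleftrightarrow> is_maximum {k. \<exists>n C. admissible_code a n k C} m"

definition is_N :: "nat \<Rightarrow> nat \<Rightarrow> bool" where
  "is_N a m \<longleftrightarrow> is_maximum {n. \<exists>k C. admissible_code a n k C} m"

end

theory Submission
  imports Defs "HOL-Computational_Algebra.Primes"
begin

text \<open>
  Let \<open>C\<close> be one of the codes considered and \<open>t = w2 - w1 = w3 - w2\<close>.  The columns of a
  generator matrix form a set \<open>S\<close> of \<open>n\<close> nonzero vectors in the \<open>k\<close>-dimensional binary space,
  and the transform \<open>F y = (\<Sum>x\<in>S. (-1)\<^bsup>x \<sqdot> y\<^esup>)\<close> is \<open>n\<close> minus twice the weight of the codeword with
  coefficient vector \<open>y\<close>.  The weight condition says that away from \<open>0\<close> the transform takes exactly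
  the values \<open>0\<close>, \<open>2t\<close> and \<open>-2t\<close>.  Fourier inversion then gives \<open>2t dvd n\<close> and
  \<open>2t dvd 2\<^sup>k\<close>.  So \<open>t\<close> is a power of two, it divides \<open>w2 = n/2\<close>, and \<open>C\<close> is
  \<open>2\<^sup>a\<close>-divisible if and only if \<open>2\<^sup>a dvd t\<close>.  For \<open>a = 1, 2, 3\<close> this leaves \<open>t = 1\<close>,
  \<open>t \<le> 2\<close> and \<open>t \<le> 4\<close>.

  \<^emph>\<open>Upper bounds.\<close>  The complement of \<open>S\<close> has the transform \<open>-F\<close> away from \<open>0\<close>; let \<open>A\<close> be
  that one of the two sets that contains at most half of the space, and let \<open>d = 2tm\<close> be its size.
  Here \<open>m \<ge> 2\<close>: if \<open>S\<close> had \<open>2t\<close> points, then \<open>w1\<close> would vanish, and if its complement had \<open>2t\<close>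
  points, then some character would be \<open>-1\<close> on all of it, although it contains \<open>0\<close>.
  Inverting \<open>F\<^sup>3 = 4t\<^sup>2 F\<close> shows that every vector outside \<open>A\<close> is a sum \<open>a + b + c\<close> of elements of
  \<open>A\<close> for exactly \<open>l = d (d\<^sup>2 - 4t\<^sup>2) / 2\<^sup>k\<close> triples, and every vector in \<open>A\<close> for exactly
  \<open>4t\<^sup>2 + l\<close>, among which are the \<open>3d - 2\<close> trivial triples \<open>x + a + a\<close>
  (\<open>three_valued_set.card_triples\<close>).  Integrality of \<open>l\<close>, the inequality \<open>3d - 2 \<le> 4t\<^sup>2 + l\<close>, and
  Parseval's identity together with the occurrence of the value \<open>0\<close> leave only finitely many
  parameters.  All of them obey the claimed bounds except \<open>t = 2\<close>, \<open>k = 7\<close>, \<open>d = 16\<close>.  There the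
  inequality is an equality, so \<open>A\<close> is a Sidon set of 16 points in dimension 7, and two applications
  of the pigeonhole principle exclude it (\<open>no_sidon_set_16\<close>).

  \<^emph>\<open>Sharpness.\<close>  The trivial code of length 3, the repetition code of length 7 and the Golay code of
  length 23 are perfect 3-error-correcting codes.  Adjoining \<open>0\<close> to the columns of a parity check
  matrix gives a set \<open>D\<close> of \<open>d = 4, 8, 24\<close> vectors in dimension \<open>k = 3, 6, 11\<close> such that each vector
  outside \<open>D\<close> is the sum of three distinct elements of \<open>D\<close> in exactly one way.  The argument of
  the upper bound can now be reversed: the number of triples with a given sum takes one value on
  \<open>D\<close> and another outside it, so the transform of \<open>D\<close> satisfies \<open>F\<^sup>3 = 4t\<^sup>2 F\<close> away from \<open>0\<close>
  (\<open>three_valued_perfect_cover\<close>), and the complement of \<open>D\<close> is the set of columns of a code of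
  length \<open>2\<^sup>k - d = 4, 56, 2024\<close>.
\<close>

section \<open>Characters of the binary space\<close>

lemma word_add_self [simp]: "(x :: nat \<Rightarrow> bit) + x = 0"
  by (simp add: fun_eq_iff)

lemma word_add_eq_0_iff: "(x :: nat \<Rightarrow> bit) + y = 0 \<longleftrightarrow> x = y"
proof
  assume "x + y = 0"
  then have "x + y + y = y" by simp
  then show "x = y" by (simp add: add.assoc)
qed simp

lemma word_add_involution [simp]: "(x :: nat \<Rightarrow> bit) + (x + y) = y"
  by (simp flip: add.assoc)

lemma word_space_0 [simp]: "0 \<in> word_space k"
  by (simp add: word_space_def)

lemma word_space_add [simp]: "x \<in> word_space k \<Longrightarrow> y \<in> word_space k \<Longrightarrow> x + y \<in> word_space k"
  by (simp add: word_space_def)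

lemma word_space_sum: "(\<And>x. x \<in> A \<Longrightarrow> f x \<in> word_space k) \<Longrightarrow> sum f A \<in> word_space k"
  by (induction A rule: infinite_finite_induct) auto

lemma bij_betw_word_space:
  "bij_betw (\<lambda>I i. of_bool (i \<in> I)) (Pow {..<k}) (word_space k)"
proof (rule bij_betw_byWitness[where f' = "\<lambda>x. {i. x i = 1}"])
  show "(\<lambda>x. {i. x i = 1}) ` word_space k \<subseteq> Pow {..<k}"
    by (auto simp: word_space_def) (metis not_le zero_neq_one)
qed (auto simp: word_space_def fun_eq_iff)

lemma finite_word_space [simp]: "finite (word_space k)"
  using bij_betw_finite[OF bij_betw_word_space] by simp

lemma finite_subset_word_space: "A \<subseteq> word_space k \<Longrightarrow> finite A"
  by (rule finite_subset[OF _ finite_word_space])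

lemma card_word_space [simp]: "card (word_space k) = 2 ^ k"
  using bij_betw_same_card[OF bij_betw_word_space] by (simp add: card_Pow)

definition dot :: "nat \<Rightarrow> (nat \<Rightarrow> bit) \<Rightarrow> (nat \<Rightarrow> bit) \<Rightarrow> bit" where
  "dot k y x = (\<Sum>i<k. y i * x i)"

lemma dot_add_right: "dot k y (x + x') = dot k y x + dot k y x'"
  by (simp only: dot_def plus_fun_apply distrib_left sum.distrib)

lemma dot_commute: "dot k y x = dot k x y"
  by (simp only: dot_def mult.commute)

lemma dot_add_left: "dot k (y + y') x = dot k y x + dot k y' x"
  by (simp only: dot_commute[of k _ x] dot_add_right)

lemma dot_0_right [simp]: "dot k y 0 = 0"
  by (simp add: dot_def)

definition unit_word :: "nat \<Rightarrow> nat \<Rightarrow> bit" where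
  "unit_word j = (\<lambda>i. of_bool (i = j))"

lemma unit_word_in_word_space [simp]: "j < k \<Longrightarrow> unit_word j \<in> word_space k"
  by (auto simp: unit_word_def word_space_def)

lemma dot_unit_word: "j < k \<Longrightarrow> dot k y (unit_word j) = y j"
proof -
  assume "j < k"
  have "dot k y (unit_word j) = (\<Sum>i<k. if i = j then y i else 0)"
    unfolding dot_def unit_word_def by (intro sum.cong) auto
  then show ?thesis using \<open>j < k\<close> by simp
qed

lemma words_differ_at:
  assumes "x \<in> word_space k" "y \<in> word_space k" "x \<noteq> y"
  shows "\<exists>j<k. x j \<noteq> y j"
  using assms by (auto simp: word_space_def fun_eq_iff) (metis not_le)

definition chi :: "nat \<Rightarrow> (nat \<Rightarrow> bit) \<Rightarrow> (nat \<Rightarrow> bit) \<Rightarrow> int" where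
  "chi k y x = (if dot k y x = 0 then 1 else - 1)"

lemma chi_add_right: "chi k y (x + x') = chi k y x * chi k y x'"
  by (simp add: chi_def dot_add_right)

lemma chi_0_right [simp]: "chi k y 0 = 1"
  by (simp add: chi_def)

lemma chi_commute: "chi k y x = chi k x y"
  by (simp add: chi_def dot_commute)

lemma chi_0_left [simp]: "chi k 0 x = 1"
  by (simp add: chi_commute[of k 0])

text \<open>Translating by a unit vector on which the character is \<open>-1\<close> turns a nontrivial character sum
  into its negative.\<close>

lemma sum_chi:
  assumes "y \<in> word_space k"
  shows "(\<Sum>x\<in>word_space k. chi k y x) = (if y = 0 then 2 ^ k else 0)"
proof (cases "y = 0")
  case False
  then obtain j where j: "j < k" "y j \<noteq> 0"
    using words_differ_at[OF assms, of 0] by auto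
  let ?e = "unit_word j"
  have e: "chi k y ?e = - 1"
    using j by (simp add: chi_def dot_unit_word)
  have "(\<Sum>x\<in>word_space k. chi k y x) = (\<Sum>x\<in>word_space k. chi k y (?e + x))"
    by (rule sum.reindex_bij_witness[of _ "\<lambda>x. ?e + x" "\<lambda>x. ?e + x"]) (use j in auto)
  then show ?thesis
    using False by (simp add: chi_add_right e sum_negf)
qed simp

definition fourier :: "nat \<Rightarrow> (nat \<Rightarrow> bit) set \<Rightarrow> (nat \<Rightarrow> bit) \<Rightarrow> int" where
  "fourier k A y = (\<Sum>x\<in>A. chi k y x)"

lemma fourier_0 [simp]: "fourier k A 0 = int (card A)"
  by (simp add: fourier_def)

lemma fourier_complement:
  assumes "A \<subseteq> word_space k" "y \<in> word_space k" "y \<noteq> 0"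
  shows "fourier k (word_space k - A) y = - fourier k A y"
  using sum_chi[OF assms(2)] assms
  by (simp add: fourier_def sum_diff)

text \<open>All the moments of a transform are instances of this formula, with \<open>P\<close> a power of the point
  set and \<open>s\<close> the sum of a tuple.\<close>

lemma sum_fourier_family:
  assumes "finite P" and s: "\<And>p. p \<in> P \<Longrightarrow> s p \<in> word_space k" and x: "x \<in> word_space k"
  shows "(\<Sum>y\<in>word_space k. (\<Sum>p\<in>P. chi k y (s p)) * chi k y x) = 2 ^ k * int (card {p\<in>P. s p = x})"
proof -
  have "(\<Sum>y\<in>word_space k. (\<Sum>p\<in>P. chi k y (s p)) * chi k y x) =
        (\<Sum>p\<in>P. \<Sum>y\<in>word_space k. chi k (s p + x) y)"
    by (subst sum.swap) (simp add: sum_distrib_right flip: chi_add_right chi_commute)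
  also have "\<dots> = (\<Sum>p\<in>P. if s p = x then 2 ^ k else 0)"
    by (intro sum.cong refl) (simp add: sum_chi s x word_add_eq_0_iff)
  also have "\<dots> = 2 ^ k * int (card {p\<in>P. s p = x})"
    using \<open>finite P\<close> by (simp add: sum.If_cases Int_def)
  finally show ?thesis .
qed

lemma fourier_inversion:
  assumes "A \<subseteq> word_space k" "x \<in> word_space k"
  shows "(\<Sum>y\<in>word_space k. fourier k A y * chi k y x) = 2 ^ k * of_bool (x \<in> A)"
proof -
  have "{p\<in>A. p = x} = (if x \<in> A then {x} else {})" by auto
  then have "card {p\<in>A. id p = x} = of_bool (x \<in> A)" by simp
  moreover have "(\<Sum>y\<in>word_space k. fourier k A y * chi k y x) = 2 ^ k * int (card {p\<in>A. id p = x})"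
    unfolding fourier_def using sum_fourier_family[of A id k x] assms
    by (simp add: finite_subset_word_space subset_iff)
  ultimately show ?thesis by simp
qed

lemma fourier_parseval:
  assumes "A \<subseteq> word_space k"
  shows "(\<Sum>y\<in>word_space k. (fourier k A y)\<^sup>2) = 2 ^ k * int (card A)"
proof -
  have fin: "finite A" using assms by (simp add: finite_subset_word_space)
  have sq: "(fourier k A y)\<^sup>2 = (\<Sum>p\<in>A\<times>A. chi k y (fst p + snd p))" for y
    by (simp add: fourier_def power2_eq_square sum_product sum.cartesian_product chi_add_right
        split_beta)
  have "{p\<in>A\<times>A. fst p + snd p = 0} = (\<lambda>a. (a, a)) ` A"
    by (auto simp: word_add_eq_0_iff)
  moreover have "card ((\<lambda>a. (a, a)) ` A) = card A"
    by (intro card_image) (auto simp: inj_on_def)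
  ultimately have "card {p\<in>A\<times>A. fst p + snd p = 0} = card A" by simp
  moreover have "fst p + snd p \<in> word_space k" if "p \<in> A \<times> A" for p
    using that assms by (intro word_space_add) auto
  ultimately show ?thesis
    using sum_fourier_family[of "A\<times>A" "\<lambda>p. fst p + snd p" k 0] fin
    by (simp add: sq)
qed

section \<open>Triple sums\<close>

definition triples :: "(nat \<Rightarrow> bit) set \<Rightarrow> (nat \<Rightarrow> bit) \<Rightarrow> ((nat \<Rightarrow> bit) \<times> (nat \<Rightarrow> bit) \<times> (nat \<Rightarrow> bit)) set"
  where "triples A x = {(a, b, c) \<in> A \<times> A \<times> A. a + b + c = x}"

lemma finite_triples: "finite A \<Longrightarrow> finite (triples A x)"
  by (rule finite_subset[of _ "A \<times> A \<times> A"]) (auto simp: triples_def)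

lemma fourier_cubed:
  "fourier k A y ^ 3 = (\<Sum>p\<in>A\<times>A\<times>A. chi k y (case p of (a, b, c) \<Rightarrow> a + b + c))"
proof -
  have "fourier k A y ^ 3 = fourier k A y * (fourier k A y * fourier k A y)"
    by (simp add: power3_eq_cube)
  also have "\<dots> = (\<Sum>p\<in>A\<times>A\<times>A. chi k y (case p of (a, b, c) \<Rightarrow> a + b + c))"
    by (simp only: fourier_def sum_product sum.cartesian_product)
      (simp add: chi_add_right split_beta sum_distrib_left sum.cartesian_product mult.assoc)
  finally show ?thesis .
qed

lemma sum_fourier_cubed:
  assumes "A \<subseteq> word_space k" "x \<in> word_space k"
  shows "(\<Sum>y\<in>word_space k. fourier k A y ^ 3 * chi k y x) = 2 ^ k * int (card (triples A x))"
proof -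
  have fin: "finite A" using assms by (simp add: finite_subset_word_space)
  let ?s = "\<lambda>(a, b, c). a + b + c :: nat \<Rightarrow> bit"
  have "triples A x = {p\<in>A\<times>A\<times>A. ?s p = x}"
    by (auto simp: triples_def)
  moreover have "?s p \<in> word_space k" if "p \<in> A \<times> A \<times> A" for p
    using that assms(1) by (auto intro!: word_space_add)
  ultimately show ?thesis
    unfolding fourier_cubed using sum_fourier_family[of "A\<times>A\<times>A" ?s k x] fin assms(2)
    by simp
qed

lemma sum_card_triples:
  assumes "A \<subseteq> word_space k"
  shows "(\<Sum>x\<in>word_space k. card (triples A x)) = card A ^ 3"
proof -
  have fin: "finite A" using assms by (simp add: finite_subset_word_space)
  have "(\<Sum>x\<in>word_space k. card (triples A x)) = card (\<Union>x\<in>word_space k. triples A x)"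
    using fin by (subst card_UN_disjoint) (simp_all add: finite_triples, auto simp: triples_def)
  also have "(\<Union>x\<in>word_space k. triples A x) = A \<times> A \<times> A"
    using assms by (auto simp: triples_def subset_iff)
  finally show ?thesis
    by (simp add: card_cartesian_product power3_eq_cube)
qed

text \<open>
  Removing \<open>x\<close> from the last two families makes the three families disjoint.
\<close>

definition trivial_triples :: "(nat \<Rightarrow> bit) set \<Rightarrow> (nat \<Rightarrow> bit) \<Rightarrow> ((nat \<Rightarrow> bit) \<times> (nat \<Rightarrow> bit) \<times> (nat \<Rightarrow> bit)) set"
  where "trivial_triples A x = (\<lambda>a. (x, a, a)) ` A \<union> (\<lambda>a. (a, x, a)) ` (A - {x}) \<union> (\<lambda>a. (a, a, x)) ` (A - {x})"

lemma trivial_triples_subset: "x \<in> A \<Longrightarrow> trivial_triples A x \<subseteq> triples A x"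
  by (auto simp: trivial_triples_def triples_def add.assoc add.commute[of _ x])

lemma card_trivial_triples:
  assumes "finite A" "x \<in> A"
  shows "card (trivial_triples A x) = 3 * card A - 2"
proof -
  have "card ((\<lambda>a. (x, a, a)) ` A) = card A" "card ((\<lambda>a. (a, x, a)) ` (A - {x})) = card A - 1"
    "card ((\<lambda>a. (a, a, x)) ` (A - {x})) = card A - 1"
    using assms by (subst card_image; auto simp: inj_on_def)+
  then have "card (trivial_triples A x) = card A + (card A - 1) + (card A - 1)"
    unfolding trivial_triples_def using assms by (subst card_Un_disjoint; auto)+
  moreover have "card A > 0" using assms by (auto simp: card_gt_0_iff)
  ultimately show ?thesis by simp
qed

lemma card_triples_ge:
  assumes "finite A" "x \<in> A"
  shows "3 * card A - 2 \<le> card (triples A x)"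
  using card_mono[OF finite_triples trivial_triples_subset] assms
  by (metis card_trivial_triples)

text \<open>A triple with two equal entries sums to its third entry; outside the set the entries are
  therefore distinct, and permuting them gives six triples.\<close>

lemma card_triples_ge_6:
  assumes "finite A" "x \<notin> A" "triples A x \<noteq> {}"
  shows "6 \<le> card (triples A x)"
proof -
  obtain a b c where abc: "a \<in> A" "b \<in> A" "c \<in> A" "a + b + c = x"
    using assms(3) by (auto simp: triples_def)
  have "a \<noteq> b" using abc assms(2) by auto
  moreover have "a \<noteq> c" using abc assms(2) by (auto simp: add.assoc add.commute[of b])
  moreover have "b \<noteq> c" using abc assms(2) by (auto simp: add.assoc)
  ultimately have "card {(a,b,c),(a,c,b),(b,a,c),(b,c,a),(c,a,b),(c,b,a)} = 6"
    by auto
  moreover have "{(a,b,c),(a,c,b),(b,a,c),(b,c,a),(c,a,b),(c,b,a)} \<subseteq> triples A x"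
    using abc by (auto simp: triples_def ac_simps)
  ultimately show ?thesis
    using card_mono[OF finite_triples[OF assms(1)]] by metis
qed

section \<open>Sets with a three-valued transform\<close>

locale three_valued_set =
  fixes k :: nat and u :: int and A :: "(nat \<Rightarrow> bit) set"
  assumes subset: "A \<subseteq> word_space k"
    and nonempty: "A \<noteq> {}"
    and proper: "A \<noteq> word_space k"
    and u_pos: "u > 0"
    and three_values: "\<And>y. y \<in> word_space k \<Longrightarrow> y \<noteq> 0 \<Longrightarrow> fourier k A y \<in> {0, u, - u}"
begin

lemma finite_points: "finite A"
  using subset by (rule finite_subset_word_space)

lemma complement: "three_valued_set k u (word_space k - A)"
proof
  show "fourier k (word_space k - A) y \<in> {0, u, - u}" if "y \<in> word_space k" "y \<noteq> 0" for y
    using three_values[OF that] fourier_complement[OF subset that] by auto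
qed (use subset nonempty proper u_pos in auto)

lemma sum_split_0:
  "(\<Sum>y\<in>word_space k. f y) = f 0 + (\<Sum>y\<in>word_space k - {0}. f y)" for f :: "_ \<Rightarrow> int"
  by (rule sum.remove) auto

lemma sum_nonzero_dvd:
  "u dvd (\<Sum>y\<in>word_space k - {0}. fourier k A y * chi k y x)"
  by (intro dvd_sum) (use three_values in fastforce)

text \<open>
  Inversion at a point outside the set writes \<open>0\<close> as the value \<open>card A\<close> at the origin plus a
  sum of multiples of \<open>u\<close>.  Inversion at a point of the set does the same for \<open>2\<^sup>k\<close>.
\<close>

lemma u_dvd_card: "u dvd int (card A)"
proof -
  obtain x where "x \<in> word_space k" "x \<notin> A" using subset proper by auto
  then show ?thesis
    using fourier_inversion[OF subset, of x] sum_nonzero_dvd[of x]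
    by (simp add: sum_split_0) (metis dvd_add_left_iff dvd_0_right)
qed

lemma u_dvd_power: "u dvd 2 ^ k"
proof -
  obtain x where "x \<in> A" using nonempty by auto
  moreover from this have "x \<in> word_space k" using subset by auto
  ultimately have "2 ^ k = int (card A) + (\<Sum>y\<in>word_space k - {0}. fourier k A y * chi k y x)"
    using fourier_inversion[OF subset, of x] by (simp add: sum_split_0)
  then show ?thesis
    using u_dvd_card sum_nonzero_dvd[of x] by (metis dvd_add)
qed

lemma parseval:
  "(int (card A))\<^sup>2 + u\<^sup>2 * int (card {y \<in> word_space k - {0}. fourier k A y \<noteq> 0})
    = 2 ^ k * int (card A)"
proof -
  have "(\<Sum>y\<in>word_space k - {0}. (fourier k A y)\<^sup>2) =
        (\<Sum>y\<in>word_space k - {0}. if fourier k A y \<noteq> 0 then u\<^sup>2 else 0)"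
  proof (intro sum.cong refl)
    fix y assume "y \<in> word_space k - {0}"
    then have "fourier k A y \<in> {0, u, - u}" using three_values by simp
    then show "(fourier k A y)\<^sup>2 = (if fourier k A y \<noteq> 0 then u\<^sup>2 else 0)" by auto
  qed
  also have "\<dots> = u\<^sup>2 * int (card {y \<in> word_space k - {0}. fourier k A y \<noteq> 0})"
    by (subst sum.If_cases) (auto simp: Int_def)
  finally show ?thesis
    using fourier_parseval[OF subset] by (simp add: sum_split_0)
qed

text \<open>Away from \<open>0\<close> the transform satisfies \<open>F\<^sup>3 = u\<^sup>2 F\<close>; inverting this relation shows
  that the number of triples depends only on whether their sum lies in the set.\<close>

lemma card_triples:
  assumes "x \<in> word_space k"
  shows "2 ^ k * int (card (triples A x)) =
    2 ^ k * u\<^sup>2 * of_bool (x \<in> A) + int (card A) * ((int (card A))\<^sup>2 - u\<^sup>2)"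
proof -
  have "(\<Sum>y\<in>word_space k - {0}. fourier k A y ^ 3 * chi k y x) =
        (\<Sum>y\<in>word_space k - {0}. u\<^sup>2 * (fourier k A y * chi k y x))"
    by (intro sum.cong refl) (use three_values in \<open>fastforce simp: power2_eq_square power3_eq_cube\<close>)
  then have "2 ^ k * int (card (triples A x)) =
    int (card A) ^ 3 + u\<^sup>2 * (\<Sum>y\<in>word_space k - {0}. fourier k A y * chi k y x)"
    using sum_fourier_cubed[OF subset assms] by (simp add: sum_split_0 sum_distrib_left)
  moreover have "(\<Sum>y\<in>word_space k - {0}. fourier k A y * chi k y x) =
    2 ^ k * of_bool (x \<in> A) - int (card A)"
    using fourier_inversion[OF subset assms] by (simp add: sum_split_0)
  ultimately show ?thesis
    by (simp only:) (simp add: algebra_simps power2_eq_square power3_eq_cube)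
qed

end

section \<open>Sidon sets in dimension seven\<close>

lemma sum_sym_diff:
  fixes A B :: "(nat \<Rightarrow> bit) set"
  assumes "finite A" "finite B"
  shows "\<Sum>(sym_diff A B) = \<Sum>A + \<Sum>B"
proof -
  have "\<Sum>A = \<Sum>(A - B) + \<Sum>(A \<inter> B)" "\<Sum>B = \<Sum>(B - A) + \<Sum>(A \<inter> B)"
    using assms by (metis sum.Int_Diff add.commute Int_commute)+
  then have "\<Sum>A + \<Sum>B = \<Sum>(A - B) + \<Sum>(B - A) + (\<Sum>(A \<inter> B) + \<Sum>(A \<inter> B))"
    by (simp only: ac_simps)
  also have "\<dots> = \<Sum>(sym_diff A B)"
    using assms by (subst sum.union_disjoint) auto
  finally show ?thesis by simp
qed

lemma card_sym_diff:
  assumes "finite A" "finite B"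
  shows "card (sym_diff A B) + 2 * card (A \<inter> B) = card A + card B"
proof -
  have "card A = card (A - B) + card (A \<inter> B)" "card B = card (B - A) + card (A \<inter> B)"
    using assms by (metis card_Int_Diff Int_commute add.commute)+
  moreover have "card (sym_diff A B) = card (A - B) + card (B - A)"
    using assms by (intro card_Un_disjoint) auto
  ultimately show ?thesis by simp
qed

text \<open>
  Relations with an even number of terms, at most four, are excluded among the elements of \<open>A\<close>.
  Counting sums of three elements produces a relation with six terms, on a set \<open>X\<close>.  Since \<open>X\<close>
  sums to zero, a subset and its complement in \<open>X\<close> have the same sum, so the sums of even subsets
  of \<open>X\<close> form a subgroup of order 16, given by the empty set and the pairs.  It has only 8 cosets in
  a space of 128 vectors, hence two of the 10 remaining points of \<open>A\<close> share a coset, and this is a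
  relation with at most four terms.
\<close>

lemma no_sidon_set_16:
  assumes A: "A \<subseteq> word_space 7" "card A = 16"
    and sidon: "\<And>a b c. a \<in> A \<Longrightarrow> b \<in> A \<Longrightarrow> c \<in> A \<Longrightarrow> a + b + c \<in> A \<Longrightarrow> a = b \<or> a = c \<or> b = c"
  shows False
proof -
  have fin: "finite A" using A(1) by (rule finite_subset_word_space)
  have small: "\<Sum>Z \<noteq> 0" if "Z \<subseteq> A" "card Z = 2 \<or> card Z = 4" for Z
    using that(2)
  proof
    assume "card Z = 2"
    then show ?thesis by (auto simp: card_2_iff word_add_eq_0_iff)
  next
    assume "card Z = 4"
    then obtain a b c d where Z: "Z = {a, b, c, d}" "distinct [a, b, c, d]"
      by (auto simp: card_Suc_eq eval_nat_numeral)
    then have "\<Sum>Z = a + b + c + d" by (simp add: add.assoc)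
    moreover have "a + b + c \<noteq> d"
      using sidon[of a b c] Z that(1) by auto
    ultimately show ?thesis by (simp add: word_add_eq_0_iff)
  qed
  \<comment> \<open>There are 560 three-element subsets, but only 128 possible sums.\<close>
  define P where "P = {Y. Y \<subseteq> A \<and> card Y = 3}"
  have "card P = 16 choose 3"
    using n_subsets[OF fin, of 3] A(2) by (simp add: P_def)
  also have "\<dots> = 560" by (simp add: binomial_fact' fact_numeral)
  finally have "card P = 560" .
  moreover have "sum id ` P \<subseteq> word_space 7"
    using A(1) by (auto simp: P_def intro!: word_space_sum)
  then have "card (sum id ` P) \<le> card (word_space 7)"
    by (intro card_mono finite_word_space)
  ultimately have "\<not> inj_on (sum id) P"
    by (intro pigeonhole) simp
  then obtain Y Y' where Y: "Y \<subseteq> A" "card Y = 3" "Y' \<subseteq> A" "card Y' = 3" "Y \<noteq> Y'" "\<Sum>Y = \<Sum>Y'"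
    by (auto simp: inj_on_def P_def id_def)
  define X where "X = sym_diff Y Y'"
  have finY: "finite Y" "finite Y'" using Y fin finite_subset by auto
  have X: "X \<subseteq> A" "\<Sum>X = 0" "finite X"
    using Y finY sum_sym_diff[OF finY] by (auto simp: X_def)
  have "card X \<noteq> 0" using Y(5) X(3) by (auto simp: X_def)
  moreover have "card X + 2 * card (Y \<inter> Y') = 6"
    using card_sym_diff[OF finY] Y by (simp add: X_def)
  moreover have "card X \<noteq> 2" "card X \<noteq> 4"
    using small[OF X(1)] X(2) by auto
  ultimately have cX: "card X = 6" by presburger
  \<comment> \<open>Modulo complements in \<open>X\<close>, the even subsets of \<open>X\<close> are these 16 ones.\<close>
  define Q where "Q = {Z. Z \<subseteq> X \<and> (card Z = 0 \<or> card Z = 2)}"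
  have Q: "Q = {Z. Z \<subseteq> X \<and> card Z = 0} \<union> {Z. Z \<subseteq> X \<and> card Z = 2}"
    by (auto simp: Q_def)
  have "card Q = (6 choose 0) + (6 choose 2)"
    unfolding Q using n_subsets[OF X(3)] cX
    by (subst card_Un_disjoint) (auto simp: X(3))
  also have "\<dots> = 16" by (simp add: choose_two)
  finally have "card ((A - X) \<times> Q) = 160"
    using X A(2) cX by (simp add: card_cartesian_product card_Diff_subset)
  moreover have "(\<lambda>(p, Z). p + \<Sum>Z) ` ((A - X) \<times> Q) \<subseteq> word_space 7"
    using A(1) X(1) by (auto simp: Q_def intro!: word_space_add word_space_sum)
  then have "card ((\<lambda>(p, Z). p + \<Sum>Z) ` ((A - X) \<times> Q)) \<le> card (word_space 7)"
    by (intro card_mono finite_word_space)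
  ultimately have "\<not> inj_on (\<lambda>(p, Z). p + \<Sum>Z) ((A - X) \<times> Q)"
    by (intro pigeonhole) simp
  then obtain p Z p' Z' where pZ: "p \<in> A - X" "p' \<in> A - X" "Z \<in> Q" "Z' \<in> Q" "(p, Z) \<noteq> (p', Z')"
    "p + \<Sum>Z = p' + \<Sum>Z'"
    unfolding inj_on_def by auto
  define D where "D = sym_diff Z Z'"
  have finZ: "finite Z" "finite Z'" using pZ X(3) finite_subset by (auto simp: Q_def)
  have D: "D \<subseteq> X" "finite D" using pZ finZ by (auto simp: D_def Q_def)
  have "card D + 2 * card (Z \<inter> Z') = card Z + card Z'"
    unfolding D_def by (rule card_sym_diff[OF finZ])
  moreover have "card Z = 0 \<or> card Z = 2" "card Z' = 0 \<or> card Z' = 2"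
    using pZ(3,4) unfolding Q_def by blast+
  ultimately have cD: "card D = 0 \<or> card D = 2 \<or> card D = 4"
    by presburger
  have sumD: "\<Sum>D = p + p'"
  proof -
    have "\<Sum>D = \<Sum>Z + \<Sum>Z'" unfolding D_def by (rule sum_sym_diff[OF finZ])
    also have "\<dots> = p + (p + \<Sum>Z) + \<Sum>Z'" by (simp flip: add.assoc)
    also have "\<dots> = p + p'" unfolding pZ(6) by (simp add: add.assoc)
    finally show ?thesis .
  qed
  show False
  proof (cases "p = p'")
    case True
    then have "D \<noteq> {}" using pZ(5) by (auto simp: D_def)
    then have "card D \<noteq> 0" using D by simp
    then show False
      using small[of D] subset_trans[OF D(1) X(1)] cD sumD True by (metis word_add_self)
  next
    case False
    have no_pair: False if "E \<subseteq> X" "card E = 0 \<or> card E = 2" "\<Sum>E = p + p'" for E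
    proof -
      have E: "finite E" "p \<notin> E" "p' \<notin> E" using that X(3) finite_subset pZ by auto
      then have "card (insert p (insert p' E)) = card E + 2" using False by simp
      then have "card (insert p (insert p' E)) = 2 \<or> card (insert p (insert p' E)) = 4"
        using that(2) by presburger
      moreover have "insert p (insert p' E) \<subseteq> A" using that(1) X(1) pZ by blast
      moreover have "\<Sum>(insert p (insert p' E)) = (p + p') + (p + p')"
        using E False that(3) by (simp only: sum.insert finite_insert insert_iff add.assoc) simp
      ultimately show False
        using small by (metis word_add_self)
    qed
    have "\<Sum>(X - D) = \<Sum>D"
      using sum.subset_diff[OF D(1) X(3), of "\<lambda>x. x"] X(2) by (simp add: word_add_eq_0_iff)
    moreover have "card (X - D) = 6 - card D"
      using D cX by (simp add: card_Diff_subset)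
    moreover have "card D = 4 \<or> card D = 0 \<or> card D = 2" using cD by blast
    ultimately show False
      using no_pair[OF D(1) _ sumD] no_pair[of "X - D"] sumD by (elim disjE) simp_all
  qed
qed

section \<open>Bounds on the dimension\<close>

text \<open>
  The first hypothesis is Parseval's identity, divided by \<open>2 t\<close>, for a set of size \<open>2 t m\<close> in a space
  of \<open>q\<close> vectors whose transform has \<open>N\<close> nonzero values away from \<open>0\<close>.  As the set fills at most half
  of the space, the term \<open>m\<^sup>2\<close> contributes at most half of the right-hand side, while \<open>N\<close> is less
  than \<open>q\<close>.
\<close>

lemma multiplier_less:
  fixes q m t N :: int
  assumes "2 * t * (m\<^sup>2 + N) = q * m" "N \<le> q - 2" "4 * t * m \<le> q" "0 < t" "2 \<le> m"
  shows "m < 4 * t"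
proof -
  have "4 * t * m * m \<le> q * m"
    using assms(3,5) by (intro mult_right_mono) auto
  moreover have "2 * t * N \<le> 2 * t * (q - 2)"
    using assms(2,4) by (intro mult_left_mono) auto
  ultimately have "q * m \<le> 4 * t * q - 8 * t"
    using assms(1) by (simp add: algebra_simps power2_eq_square)
  then have "q * m < q * (4 * t)"
    using assms(4) by (simp add: algebra_simps)
  moreover have "0 < q" using assms(3-5) by (smt (verit) mult_pos_pos)
  ultimately show ?thesis by simp
qed

text \<open>
  The numerical constraints for a set of size \<open>2 t m\<close> with transform values \<open>0, 2t, -2t\<close>: \<open>l\<close> is the
  number of triples with a given sum outside the set, \<open>N\<close> the number of nonzero transform values away
  from the origin, and \<open>q\<close> the size of the space.  A dimension above the claimed
  bound makes \<open>q\<close> a multiple of \<open>16\<close>, \<open>128\<close> or \<open>4096\<close>, according to \<open>t\<close>.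
\<close>

context
  fixes k m l N t :: int and q :: int
  assumes l: "q * l = 8 * t ^ 3 * (m * (m\<^sup>2 - 1))"
    and l_ge: "6 * t * m - 2 \<le> 4 * t\<^sup>2 + l"
    and N: "2 * t * (m\<^sup>2 + N) = q * m" "N \<le> q - 2"
    and half: "4 * t * m \<le> q" and m: "2 \<le> m"
    and l_nonneg: "0 \<le> l"
begin

text \<open>
  Replacing \<open>r * l\<close> by one variable makes the constraints linear once \<open>m\<close> is a numeral.
\<close>

lemma multiple_of_l:
  assumes "q = c * r" "1 \<le> r"
  obtains z where "l \<le> z" "c * z = 8 * t ^ 3 * (m * (m\<^sup>2 - 1))" "z = r * l"
proof
  show "l \<le> r * l" using mult_right_mono[of 1 r l] assms(2) l_nonneg by simp
  show "c * (r * l) = 8 * t ^ 3 * (m * (m\<^sup>2 - 1))" using l assms(1) by (simp add: mult.assoc)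
qed simp

lemma no_parameters_1_16:
  assumes "t = 1" "q = 16 * r" "1 \<le> r" shows False
proof -
  obtain z where z: "l \<le> z" "16 * z = 8 * t ^ 3 * (m * (m\<^sup>2 - 1))"
    using multiple_of_l[OF assms(2,3)] .
  have "m < 4" using multiplier_less[OF N half _ m] assms by simp
  then have "m = 2 \<or> m = 3" using m by auto
  then show False
  proof
    assume "m = 2"
    then show False using z l_ge assms by simp
  next
    assume "m = 3"
    then show False using N assms by simp
  qed
qed

lemma parameters_2_128:
  assumes "t = 2" "q = 128 * r" "1 \<le> r" shows "m = 4 \<and> r = 1 \<and> l = 30"
proof -
  obtain z where z: "l \<le> z" "128 * z = 8 * t ^ 3 * (m * (m\<^sup>2 - 1))" "z = r * l"
    using multiple_of_l[OF assms(2,3)] .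
  have "m < 8" using multiplier_less[OF N half _ m] assms by simp
  then consider "m = 2" | "m = 3" | "m = 4" | "m = 5" | "m = 6" | "m = 7" using m by linarith
  then show ?thesis
  proof cases
    case 3
    then have "l = 30" "z = 30" using z(1,2) l_ge assms by auto
    then show ?thesis using z(3) 3 by simp
  qed (use z(1,2) l_ge N assms in simp_all)
qed

lemma no_parameters_4_4096:
  assumes "t = 4" "q = 4096 * r" "1 \<le> r" shows False
proof -
  obtain z where z: "l \<le> z" "4096 * z = 8 * t ^ 3 * (m * (m\<^sup>2 - 1))"
    using multiple_of_l[OF assms(2,3)] .
  have "m < 16" using multiplier_less[OF N half _ m] assms by simp
  \<comment> \<open>In a space of at least 4096 vectors, Parseval's identity halves the bound on \<open>m\<close>: with only
    \<open>q - 2\<close> nonzero values of square \<open>(2t)\<^sup>2\<close>, it reads \<open>q (m - 8) \<le> 8 (m\<^sup>2 - 2)\<close>.\<close>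
  have "m \<le> 8"
  proof (rule ccontr)
    assume "\<not> m \<le> 8"
    then have "4096 * 1 \<le> q * (m - 8)"
      using assms by (intro mult_mono) auto
    also have "\<dots> \<le> 8 * (m * m)"
      using N assms(1) by (simp add: algebra_simps power2_eq_square)
    also have "m * m \<le> 15 * 15"
      using \<open>m < 16\<close> m by (intro mult_mono) auto
    finally show False by simp
  qed
  then consider "m = 2" | "m = 3" | "m = 4" | "m = 5" | "m = 6" | "m = 7" | "m = 8"
    using m by linarith
  then show False
  proof cases
    case 1
    then have "4 * z = 3" using z assms by simp
    then show False by presburger
  qed (use z l_ge assms in simp_all)
qed

lemma multiplier_4_2048:
  assumes "t = 4" "q = 2048" shows "3 \<le> m"
proof (rule ccontr)
  assume "\<not> 3 \<le> m"
  then have "m = 2" using m by simp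
  then have "2 * l = 3" using l assms by simp
  then show False by presburger
qed

end

context three_valued_set
begin

text \<open>
  The case \<open>card A = 2 * t\<close> has to be excluded by hypothesis: affine subspaces with \<open>2 * t\<close>
  elements exist in every larger dimension, and their transforms take only the values \<open>0, 2t, -2t\<close>.
\<close>

theorem dimension_bound:
  assumes u: "u = 2 * int t" and t: "t \<in> {1, 2, 4}"
    and half: "2 * card A \<le> 2 ^ k" and card_neq: "card A \<noteq> 2 * t"
    and zero: "y0 \<in> word_space k" "y0 \<noteq> 0" "fourier k A y0 = 0"
  shows "(t = 1 \<longrightarrow> k \<le> 3) \<and> (t = 2 \<longrightarrow> k \<le> 6) \<and> (t = 4 \<longrightarrow> k \<le> 11) \<and>
    4 * t \<le> card A \<and> (t = 4 \<and> k = 11 \<longrightarrow> 24 \<le> card A)"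
proof -
  define q :: int where "q = 2 ^ k"
  obtain m where card_eq: "int (card A) = 2 * int t * m"
    using u_dvd_card u by auto
  have t_pos: "0 < t" using t by auto
  have "card A > 0" using nonempty finite_points by (simp add: card_gt_0_iff)
  then have "0 < 2 * int t * m" using card_eq by linarith
  then have "0 < m" using t_pos by (simp add: zero_less_mult_iff)
  moreover have "m \<noteq> 1" using card_eq card_neq by auto
  ultimately have m: "2 \<le> m" by simp
  have half': "4 * int t * m \<le> q"
  proof -
    have "int (2 * card A) \<le> int (2 ^ k)" using half by (simp only: of_nat_le_iff)
    then show ?thesis using card_eq by (simp add: q_def)
  qed
  obtain x where x: "x \<in> word_space k" "x \<notin> A" using subset proper by auto
  define l where "l = int (card (triples A x))"
  have ql: "q * l = int (card A) * ((int (card A))\<^sup>2 - u\<^sup>2)"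
    using card_triples[OF x(1)] x(2) by (simp add: q_def l_def)
  then have l: "q * l = 8 * int t ^ 3 * (m * (m\<^sup>2 - 1))"
    by (simp add: card_eq u algebra_simps power2_eq_square power3_eq_cube)
  have inside: "int (card (triples A a)) = u\<^sup>2 + l" if "a \<in> A" for a
  proof -
    have "q * int (card (triples A a)) = q * (u\<^sup>2 + l)"
      using card_triples[of a] that subset ql by (auto simp: q_def algebra_simps)
    then show ?thesis by (simp add: q_def)
  qed
  have l_ge: "6 * int t * m - 2 \<le> 4 * (int t)\<^sup>2 + l"
  proof -
    obtain a where a: "a \<in> A" using nonempty by auto
    have "3 * int (card A) - 2 \<le> int (card (triples A a))"
      using card_triples_ge[OF finite_points a] by linarith
    then show ?thesis
      using inside[OF a] card_eq u by (simp add: power2_eq_square)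
  qed
  define N where "N = int (card {y \<in> word_space k - {0}. fourier k A y \<noteq> 0})"
  have N: "2 * int t * (m\<^sup>2 + N) = q * m"
  proof -
    have "(2 * int t) * (2 * int t * (m\<^sup>2 + N)) = (2 * int t) * (q * m)"
      using parseval unfolding card_eq u N_def q_def
      by (simp add: algebra_simps power2_eq_square)
    then show ?thesis using t_pos by (simp only: mult_cancel_left) simp
  qed
  have N_le: "N \<le> q - 2"
  proof -
    have "{y \<in> word_space k - {0}. fourier k A y \<noteq> 0} \<subseteq> word_space k - {0, y0}"
      using zero by auto
    then have "card {y \<in> word_space k - {0}. fourier k A y \<noteq> 0} \<le> card (word_space k - {0, y0})"
      by (intro card_mono) auto
    also have "\<dots> = 2 ^ k - 2"
      using zero by (subst card_Diff_subset) auto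
    finally have "N \<le> int (2 ^ k - 2)" by (simp add: N_def)
    moreover have "2 \<le> (2 :: nat) ^ k"
      using card_mono[OF finite_word_space, of "{0, y0}" k] zero by auto
    ultimately show ?thesis by (simp add: q_def of_nat_diff)
  qed
  note bounds = l l_ge N N_le half' m
  have l_nonneg: "0 \<le> l" by (simp add: l_def)
  have split_q: "q = 2 ^ j * 2 ^ (k - j)" "(1 :: int) \<le> 2 ^ (k - j)" if "j \<le> k" for j
    using that by (simp_all add: q_def flip: power_add)
  have "k \<le> 3" if "t = 1"
    using no_parameters_1_16[OF bounds l_nonneg, of "2 ^ (k - 4)"] split_q[of 4] that by fastforce
  moreover have "k \<le> 6" if t2: "t = 2"
  proof (rule ccontr)
    assume "\<not> k \<le> 6"
    then have m4: "m = 4 \<and> (2 :: int) ^ (k - 7) = 1 \<and> l = 30"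
      using parameters_2_128[OF bounds l_nonneg, of "2 ^ (k - 7)"] split_q[of 7] t2 by simp
    then have "k = 7"
      using one_less_power[of "2 :: int" "k - 7"] \<open>\<not> k \<le> 6\<close> by (cases "0 < k - 7") auto
    \<comment> \<open>Now \<open>u\<^sup>2 + l = 46 = 3 * 16 - 2\<close>, so there is no room for nontrivial triples.\<close>
    have card16: "card A = 16" using card_eq m4 t2 by simp
    show False
    proof (rule no_sidon_set_16)
      show "A \<subseteq> word_space 7" using subset \<open>k = 7\<close> by simp
      fix a b c assume abc: "a \<in> A" "b \<in> A" "c \<in> A" "a + b + c \<in> A"
      let ?x = "a + b + c"
      have "card (triples A ?x) = 46"
        using inside[OF abc(4)] u t2 m4 by simp
      then have "trivial_triples A ?x = triples A ?x"
        using card_trivial_triples[OF finite_points abc(4)] card16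
        by (intro card_subset_eq finite_triples finite_points trivial_triples_subset abc) simp
      moreover have "(a, b, c) \<in> triples A ?x" using abc by (simp add: triples_def)
      ultimately have "(a, b, c) \<in> trivial_triples A ?x" by simp
      then show "a = b \<or> a = c \<or> b = c" unfolding trivial_triples_def by blast
    qed (rule card16)
  qed
  moreover have "k \<le> 11" if "t = 4"
    using no_parameters_4_4096[OF bounds l_nonneg, of "2 ^ (k - 12)"] split_q[of 12] that by fastforce
  moreover have "24 \<le> card A" if "t = 4" "k = 11"
    using multiplier_4_2048[OF bounds l_nonneg] card_eq that by (simp add: q_def)
  moreover have "4 * t \<le> card A"
  proof -
    have "2 * int t * 2 \<le> 2 * int t * m" using m t_pos by (intro mult_left_mono) auto
    then show ?thesis using card_eq by linarith
  qed
  ultimately show ?thesis by blast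
qed

end

section \<open>Projective codes as point sets\<close>

definition encode :: "nat \<Rightarrow> (nat \<Rightarrow> nat \<Rightarrow> bit) \<Rightarrow> (nat \<Rightarrow> bit) \<Rightarrow> (nat \<Rightarrow> bit)" where
  "encode k col y = (\<lambda>i. dot k y (col i))"

lemma encode_add: "encode k col (y + y') = encode k col y + encode k col y'"
  unfolding encode_def by (rule ext) (simp only: dot_add_left plus_fun_apply)

lemma encode_0 [simp]: "encode k col 0 = 0"
  by (rule ext) (simp add: encode_def dot_def)

lemma inj_on_encode:
  assumes "\<And>y. y \<in> word_space k \<Longrightarrow> encode k col y = 0 \<Longrightarrow> y = 0"
  shows "inj_on (encode k col) (word_space k)"
proof (rule inj_onI)
  fix y y' assume "y \<in> word_space k" "y' \<in> word_space k" "encode k col y = encode k col y'"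
  then show "y = y'"
    using assms[of "y + y'"] by (simp add: encode_add word_add_eq_0_iff)
qed

lemma sum_apply: "(\<Sum>j\<in>J. f j) i = (\<Sum>j\<in>J. f j i)" for f :: "'b \<Rightarrow> 'c \<Rightarrow> 'a :: comm_monoid_add"
  by (induction J rule: infinite_finite_induct) auto

text \<open>
  With respect to a basis, every codeword is a coefficient vector paired with the columns of the
  generator matrix.
\<close>

lemma linear_code_encode:
  assumes "linear_code n k C"
  obtains col where "\<And>i. col i \<in> word_space k" "bij_betw (encode k col) (word_space k) C"
proof -
  have C: "C \<subseteq> word_space n" "word.subspace C" "word.dim C = k"
    using assms by (auto simp: linear_code_def)
  obtain B where B: "B \<subseteq> C" "\<not> word.dependent B" "C \<subseteq> word.span B" "card B = word.dim C"
    using word.basis_exists .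
  have finB: "finite B"
    using B(1) C(1) finite_subset_word_space by (metis order_trans)
  have span: "word.span B = C"
    using word.span_subspace[OF B(1,3) C(2)] .
  obtain b where b: "bij_betw b {..<k} B"
    using ex_bij_betw_nat_finite[OF finB] B(4) C(3) by (auto simp: atLeast0LessThan)
  define col where "col = (\<lambda>i j. if j < k then b j i else 0)"
  have encode: "encode k col y = (\<Sum>j<k. word_scale (y j) (b j))" for y
    unfolding encode_def dot_def col_def word_scale_def
    by (rule ext) (simp only: sum_apply, rule sum.cong, simp_all)
  have reindex: "(\<Sum>v\<in>B. word_scale (f v) v) = (\<Sum>j<k. word_scale (f (b j)) (b j))" for f
    using sum.reindex_bij_betw[OF b, of "\<lambda>v. word_scale (f v) v"] by simp
  have "inj_on (encode k col) (word_space k)"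
  proof (rule inj_on_encode)
    fix y assume y: "y \<in> word_space k" "encode k col y = 0"
    let ?f = "\<lambda>v. y (the_inv_into {..<k} b v)"
    have inv: "?f (b j) = y j" if "j < k" for j
      using that b by (simp add: the_inv_into_f_f bij_betw_def)
    have "(\<Sum>v\<in>B. word_scale (?f v) v) = 0"
      using y(2) by (simp add: reindex encode inv)
    then have "?f v = 0" if "v \<in> B" for v
      using word.independentD[OF B(2) finB subset_refl, of ?f] that by simp
    then have "y j = 0" if "j < k" for j
      using that inv[OF that] b by (metis bij_betwE lessThan_iff)
    then show "y = 0"
      using y(1) by (auto simp: word_space_def fun_eq_iff) (metis not_le)
  qed
  moreover have "encode k col ` word_space k = C"
  proof
    show "encode k col ` word_space k \<subseteq> C"
      using b B(1) C(2)
      by (auto simp: encode bij_betw_def intro!: word.subspace_sum word.subspace_scale)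
    show "C \<subseteq> encode k col ` word_space k"
    proof
      fix c assume "c \<in> C"
      then obtain f where "c = (\<Sum>v\<in>B. word_scale (f v) v)"
        using word.span_finite[OF finB] span by auto
      then have "c = encode k col (\<lambda>j. if j < k then f (b j) else 0)"
        unfolding encode reindex by (simp only:) (rule sum.cong, simp_all)
      moreover have "(\<lambda>j. if j < k then f (b j) else 0) \<in> word_space k"
        by (simp add: word_space_def)
      ultimately show "c \<in> encode k col ` word_space k" by blast
    qed
  qed
  ultimately show thesis
    using that[of col] by (auto simp: bij_betw_def col_def word_space_def)
qed

lemma card_linear_code: "linear_code n k C \<Longrightarrow> card C = 2 ^ k"
  by (metis linear_code_encode bij_betw_same_card card_word_space)

definition point_weight :: "nat \<Rightarrow> (nat \<Rightarrow> bit) set \<Rightarrow> (nat \<Rightarrow> bit) \<Rightarrow> nat" where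
  "point_weight k S y = card {x \<in> S. dot k y x \<noteq> 0}"

lemma fourier_eq_point_weight:
  assumes "finite S"
  shows "fourier k S y = int (card S) - 2 * int (point_weight k S y)"
proof -
  have "fourier k S y = (\<Sum>x\<in>S. 1 - 2 * of_bool (dot k y x \<noteq> 0))"
    unfolding fourier_def chi_def by (intro sum.cong) auto
  also have "\<dots> = int (card S) - 2 * int (point_weight k S y)"
    using assms
    by (simp add: sum_subtractf point_weight_def Int_def flip: sum_distrib_left)
  finally show ?thesis .
qed

lemma point_weight_0 [simp]: "point_weight k S 0 = 0"
  by (simp add: point_weight_def dot_def)

lemma weight_encode:
  assumes "inj_on col {..<n}"
  shows "weight n (encode k col y) = point_weight k (col ` {..<n}) y"
proof -
  have "{x \<in> col ` {..<n}. dot k y x \<noteq> 0} = col ` {i. i < n \<and> dot k y (col i) \<noteq> 0}"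
    by auto
  moreover have "inj_on col {i. i < n \<and> dot k y (col i) \<noteq> 0}"
    using assms by (rule inj_on_subset) auto
  ultimately show ?thesis
    by (simp add: weight_def point_weight_def encode_def card_image)
qed

lemma weight_eq_0_iff:
  assumes "c \<in> word_space n"
  shows "weight n c = 0 \<longleftrightarrow> c = 0"
proof
  assume "weight n c = 0"
  then have "{i. i < n \<and> c i \<noteq> 0} = {}" by (simp add: weight_def)
  then show "c = 0" using words_differ_at[OF assms word_space_0] by (cases "c = 0") auto
qed (simp add: weight_def)

lemma point_weight_image:
  assumes "\<And>y. y \<in> word_space k \<Longrightarrow> y \<noteq> 0 \<Longrightarrow> point_weight k S y \<noteq> 0"
  shows "point_weight k S ` word_space k - {0} = point_weight k S ` (word_space k - {0})"
proof
  show "point_weight k S ` word_space k - {0} \<subseteq> point_weight k S ` (word_space k - {0})"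
    using point_weight_0 by fastforce
  show "point_weight k S ` (word_space k - {0}) \<subseteq> point_weight k S ` word_space k - {0}"
  proof
    fix x assume "x \<in> point_weight k S ` (word_space k - {0})"
    then obtain y where "y \<in> word_space k" "y \<noteq> 0" "x = point_weight k S y" by blast
    then show "x \<in> point_weight k S ` word_space k - {0}" using assms[of y] by simp
  qed
qed

lemma nonzero_weights_eq: "nonzero_weights n C = weight n ` C - {0}"
  by (auto simp: nonzero_weights_def)

text \<open>
  Full length means that no column of a generator matrix vanishes, and projectivity that the columns
  are distinct, so that they may be treated as a set of points.
\<close>

lemma projective_code_points:
  assumes "linear_code n k C" "projective n C"
  obtains S where "S \<subseteq> word_space k - {0}" "card S = n"
    "nonzero_weights n C = point_weight k S ` (word_space k - {0})"
proof -
  obtain col where col: "\<And>i. col i \<in> word_space k" and bij: "bij_betw (encode k col) (word_space k) C"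
    using linear_code_encode[OF assms(1)] by metis
  have C: "C = encode k col ` word_space k" using bij by (simp add: bij_betw_def)
  have inj: "inj_on col {..<n}"
  proof (rule inj_onI)
    fix i j assume ij: "i \<in> {..<n}" "j \<in> {..<n}" "col i = col j"
    then have "\<forall>c\<in>C. c i = c j" by (auto simp: C encode_def)
    then show "i = j" using assms(2) ij by (auto simp: projective_def)
  qed
  have nz: "col i \<noteq> 0" if "i < n" for i
  proof
    assume "col i = 0"
    then have "\<forall>c\<in>C. c i = 0" by (auto simp: C encode_def)
    then show False using assms(2) that unfolding projective_def full_length_def by blast
  qed
  let ?S = "col ` {..<n}"
  have w: "weight n ` C = point_weight k ?S ` word_space k"
    unfolding C image_image weight_encode[OF inj] ..
  have pos: "point_weight k ?S y \<noteq> 0" if "y \<in> word_space k" "y \<noteq> 0" for y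
  proof -
    have "encode k col y \<noteq> encode k col 0"
      using bij that word_space_0 unfolding bij_betw_def inj_on_def by blast
    moreover have "encode k col y \<in> word_space n"
      using assms(1) that C by (auto simp: linear_code_def)
    ultimately show ?thesis
      using weight_eq_0_iff weight_encode[OF inj] by (metis encode_0)
  qed
  have "nonzero_weights n C = point_weight k ?S ` word_space k - {0}"
    unfolding w[symmetric] by (rule nonzero_weights_eq)
  also have "\<dots> = point_weight k ?S ` (word_space k - {0})"
    using pos by (rule point_weight_image)
  finally have W: "nonzero_weights n C = point_weight k ?S ` (word_space k - {0})" .
  show thesis
  proof (rule that[OF _ _ W])
    show "?S \<subseteq> word_space k - {0}" using col nz by auto
    show "card ?S = n" using inj by (simp add: card_image)
  qed
qed

text \<open>
  Conversely, if every nonzero \<open>y\<close> has positive weight then encoding is injective; the dimension of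
  the resulting code is then read off from its cardinality.
\<close>

lemma projective_code_of_points:
  assumes S: "S \<subseteq> word_space k - {0}"
    and pos: "\<And>y. y \<in> word_space k \<Longrightarrow> y \<noteq> 0 \<Longrightarrow> point_weight k S y \<noteq> 0"
  obtains C where "linear_code (card S) k C" "projective (card S) C"
    "nonzero_weights (card S) C = point_weight k S ` (word_space k - {0})"
proof -
  define n where "n = card S"
  have finS: "finite S" using S finite_subset_word_space[of S k] by blast
  obtain s where s: "bij_betw s {..<n} S"
    using ex_bij_betw_nat_finite[OF finS] by (auto simp: atLeast0LessThan n_def)
  define col where "col = (\<lambda>i. if i < n then s i else 0)"
  have inj: "inj_on col {..<n}" and img: "col ` {..<n} = S"
    using s by (auto simp: bij_betw_def col_def inj_on_def)
  have weight: "weight n (encode k col y) = point_weight k S y" for y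
    using weight_encode[OF inj] img by simp
  define C where "C = encode k col ` word_space k"
  have "inj_on (encode k col) (word_space k)"
    using pos weight by (intro inj_on_encode) (metis encode_0 point_weight_0)
  then have "card C = 2 ^ k" by (simp add: C_def card_image)
  have sub: "C \<subseteq> word_space n"
    by (auto simp: C_def word_space_def encode_def col_def)
  have "word.subspace C"
    unfolding word.subspace_def
  proof (intro conjI ballI allI)
    show "0 \<in> C" unfolding C_def using encode_0 word_space_0 by (metis image_eqI)
    show "x + y \<in> C" if "x \<in> C" "y \<in> C" for x y
      using that unfolding C_def by (auto simp flip: encode_add)
    show "word_scale b x \<in> C" if "x \<in> C" for b x
      using that \<open>0 \<in> C\<close> by (cases b) simp_all
  qed
  then have lin': "linear_code n (word.dim C) C"
    using sub by (simp add: linear_code_def)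
  then have "(2 :: nat) ^ word.dim C = 2 ^ k"
    using card_linear_code \<open>card C = 2 ^ k\<close> by metis
  then have lin: "linear_code n k C" using lin' by simp
  \<comment> \<open>The codeword of the \<open>j\<close>-th unit vector lists the \<open>j\<close>-th coordinates of the columns.\<close>
  have coordinate: "\<exists>c\<in>C. c i = x j \<and> c i' = x' j"
    if "j < k" "col i = x" "col i' = x'" for i i' j x x'
  proof
    show "encode k col (unit_word j) \<in> C" using that by (auto simp: C_def)
    show "encode k col (unit_word j) i = x j \<and> encode k col (unit_word j) i' = x' j"
      using that by (simp add: encode_def dot_commute[of k "unit_word j"] dot_unit_word)
  qed
  have col: "col i \<in> word_space k" "col i \<noteq> 0" if "i < n" for i
    using img S that by auto
  have "projective n C"
    unfolding projective_def full_length_def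
  proof (intro conjI notI; clarsimp)
    fix i assume i: "i < n" "\<forall>c\<in>C. c i = 0"
    obtain j where "j < k" "col i j \<noteq> 0"
      using words_differ_at[OF col(1)[OF i(1)] word_space_0 col(2)[OF i(1)]] by auto
    then show False using coordinate[OF _ refl refl, of j i i] i(2) by auto
  next
    fix i i' assume i: "i < n" "i' < n" "i \<noteq> i'" "\<forall>c\<in>C. c i = c i'"
    then have "col i \<noteq> col i'" using inj by (auto simp: inj_on_def)
    then obtain j where "j < k" "col i j \<noteq> col i' j"
      using words_differ_at[OF col(1)[OF i(1)] col(1)[OF i(2)]] by auto
    then show False using coordinate[OF _ refl refl, of j i i'] i(4) by auto
  qed
  moreover have "weight n ` C = point_weight k S ` word_space k"
    unfolding C_def image_image weight ..
  then have "nonzero_weights n C = point_weight k S ` word_space k - {0}"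
    unfolding nonzero_weights_eq by simp
  moreover have "point_weight k S ` word_space k - {0} = point_weight k S ` (word_space k - {0})"
    using pos by (rule point_weight_image)
  ultimately show thesis
    using that lin by (simp add: n_def)
qed

section \<open>Bounds for three-weight codes\<close>

text \<open>
  Here \<open>t\<close> is the common difference of the weights.  It divides the middle weight \<open>n / 2\<close>, hence
  all three weights are multiples of \<open>2\<^sup>a\<close> as soon as \<open>t\<close> is.  The witness \<open>y1\<close> comes from a
  codeword of weight \<open>w1\<close>, and \<open>n \<noteq> 2 * t\<close> expresses \<open>w1 \<noteq> 0\<close>.
\<close>

lemma admissible_code_points:
  assumes "admissible_code a n k C"
  obtains t S y0 y1 where "three_valued_set k (2 * int t) S" "card S = n" "0 \<notin> S"
    "t dvd 2 ^ k" "\<not> 2 ^ a dvd t" "n \<noteq> 2 * t"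
    "y0 \<in> word_space k" "y0 \<noteq> 0" "fourier k S y0 = 0"
    "y1 \<in> word_space k" "y1 \<noteq> 0" "fourier k S y1 = 2 * int t"
proof -
  obtain w1 w2 w3 where lin: "linear_code n k C" and proj: "projective n C"
    and lt: "w1 < w2" "w2 < w3" and W: "nonzero_weights n C = {w1, w2, w3}"
    and eqs: "real w1 + real w2 + real w3 = 3 * real n / 2" "real w2 = real n / 2"
    and ndiv: "\<not> divisible_code (2 ^ a) n C"
    using assms unfolding admissible_code_def by blast
  define t where "t = w2 - w1"
  have n: "n = 2 * w2" using eqs(2) by simp
  have "real (w1 + w3) = real (2 * w2)"
    unfolding of_nat_add of_nat_mult of_nat_numeral using eqs by linarith
  then have "w1 + w3 = 2 * w2" unfolding of_nat_eq_iff .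
  then have t: "w1 + t = w2" "w3 = w2 + t" "0 < t" using lt by (simp_all add: t_def)
  have w1: "w1 \<noteq> 0" using W by (auto simp: nonzero_weights_def)
  obtain S where S: "S \<subseteq> word_space k - {0}" "card S = n"
    and "nonzero_weights n C = point_weight k S ` (word_space k - {0})"
    using projective_code_points[OF lin proj] .
  then have pw: "point_weight k S ` (word_space k - {0}) = {w1, w2, w3}" using W by simp
  have finS: "finite S" using S(1) finite_subset_word_space[of S k] by blast
  have F: "fourier k S y = int n - 2 * int (point_weight k S y)" for y
    using fourier_eq_point_weight[OF finS] S(2) by simp
  interpret three_valued_set k "2 * int t" S
  proof
    show "S \<noteq> {}" using S(2) n lt by auto
    show "S \<noteq> word_space k" using S(1) word_space_0 by blast
    fix y :: "nat \<Rightarrow> bit" assume "y \<in> word_space k" "y \<noteq> 0"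
    then have "point_weight k S y \<in> {w1, w2, w3}" using pw by blast
    then show "fourier k S y \<in> {0, 2 * int t, - (2 * int t)}"
      using t n by (auto simp: F)
  qed (use S t in auto)
  have "int (2 * t) dvd int (2 * w2)" using u_dvd_card S(2) n by simp
  then have t_w2: "t dvd w2" unfolding int_dvd_int_iff by simp
  have "int (2 * t) dvd int (2 ^ k)" using u_dvd_power by simp
  then have "t dvd 2 ^ k" unfolding int_dvd_int_iff using dvd_mult_right dvd_trans by blast
  moreover have "\<not> 2 ^ a dvd t"
  proof
    assume "2 ^ a dvd t"
    then have "2 ^ a dvd w2" "2 ^ a dvd w1" "2 ^ a dvd w3"
      using t t_w2 by (auto simp: dvd_trans)
    then have "2 ^ a dvd w" if "w \<in> nonzero_weights n C" for w
      using that W by auto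
    then have "2 ^ a dvd weight n c" if "c \<in> C" for c
      using that by (cases "weight n c = 0") (auto simp: nonzero_weights_def)
    then show False using ndiv by (simp add: divisible_code_def)
  qed
  moreover have "n \<noteq> 2 * t" using n t w1 by simp
  moreover obtain y0 where "y0 \<in> word_space k - {0}" "point_weight k S y0 = w2"
    using pw by (metis imageE insertI1 insertI2)
  moreover obtain y1 where "y1 \<in> word_space k - {0}" "point_weight k S y1 = w1"
    using pw by (metis imageE insertI1)
  ultimately show thesis
    using that[of t S y0 y1] three_valued_set_axioms S n t by (auto simp: F)
qed

text \<open>
  The dimension bound applies to \<open>S\<close> or to its complement, whichever is not larger than half of the
  space.  If \<open>S\<close> is the smaller one, its size is at most \<open>2\<^sup>k / 2\<close>, which does not exceed the claim; otherwise the
  lower bound on the size of the complement gives the bound on the length.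
\<close>

lemma parameter_bounds:
  assumes "three_valued_set k (2 * int t) S" and t: "t \<in> {1, 2, 4}"
    and "0 \<notin> S" "card S \<noteq> 2 * t"
    and y0: "y0 \<in> word_space k" "y0 \<noteq> 0" "fourier k S y0 = 0"
    and y1: "y1 \<in> word_space k" "y1 \<noteq> 0" "fourier k S y1 = 2 * int t"
  shows "(t = 1 \<longrightarrow> k \<le> 3 \<and> card S \<le> 4) \<and> (t = 2 \<longrightarrow> k \<le> 6 \<and> card S \<le> 56) \<and>
    (t = 4 \<longrightarrow> k \<le> 11 \<and> card S \<le> 2024)"
proof -
  interpret S: three_valued_set k "2 * int t" S by fact
  have pow: "(2 :: nat) ^ k \<le> 2 ^ j" if "k \<le> j" for j
    using that by (simp add: power_increasing)
  show ?thesis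
  proof (cases "2 * card S \<le> 2 ^ k")
    case True
    then have "(t = 1 \<longrightarrow> k \<le> 3) \<and> (t = 2 \<longrightarrow> k \<le> 6) \<and> (t = 4 \<longrightarrow> k \<le> 11)"
      using S.dimension_bound[OF refl t True \<open>card S \<noteq> 2 * t\<close> y0] by blast
    then show ?thesis using True pow[of 3] pow[of 6] pow[of 11] by auto
  next
    case False
    let ?D = "word_space k - S"
    interpret D: three_valued_set k "2 * int t" ?D by (rule S.complement)
    have card_D: "card ?D + card S = 2 ^ k"
      using card_Diff_subset[OF S.finite_points S.subset] card_mono[OF finite_word_space S.subset]
      by simp
    \<comment> \<open>If the complement had \<open>2 t\<close> points, the character of \<open>y1\<close> would be \<open>-1\<close> on all of them, but the
      origin is one of them.\<close>
    have "card ?D \<noteq> 2 * t"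
    proof
      assume eq: "card ?D = 2 * t"
      have "fourier k ?D y1 = - int (card ?D)"
        using fourier_complement[OF S.subset y1(1,2)] y1(3) eq by simp
      moreover have "fourier k ?D y1 = 1 + (\<Sum>x\<in>?D - {0}. chi k y1 x)"
        unfolding fourier_def using \<open>0 \<notin> S\<close> by (subst sum.remove[of _ 0]) auto
      moreover have "(\<Sum>x\<in>?D - {0}. - 1) \<le> (\<Sum>x\<in>?D - {0}. chi k y1 x)"
        by (intro sum_mono) (simp add: chi_def)
      moreover have "card (?D - {0}) < card ?D"
        using \<open>0 \<notin> S\<close> by (intro card_Diff1_less) auto
      moreover have "(\<Sum>x\<in>?D - {0}. - 1) = - int (card (?D - {0}))" by simp
      ultimately show False by linarith
    qed
    then have "(t = 1 \<longrightarrow> k \<le> 3) \<and> (t = 2 \<longrightarrow> k \<le> 6) \<and> (t = 4 \<longrightarrow> k \<le> 11) \<and> 4 * t \<le> card ?D \<and>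
        (t = 4 \<and> k = 11 \<longrightarrow> 24 \<le> card ?D)"
      using D.dimension_bound[OF refl t, of y0] fourier_complement[OF S.subset y0(1,2)] y0
        card_D False by simp
    note D = this
    consider "t = 1" | "t = 2" | "t = 4" using t by auto
    then show ?thesis
    proof cases
      case 3
      then have "k \<le> 10 \<or> k = 11" using D by auto
      then show ?thesis using D card_D pow[of 10] 3 by auto
    qed (use D card_D pow[of 3] pow[of 6] in auto)
  qed
qed

lemma admissible_code_bounds:
  assumes "admissible_code a n k C"
  shows "(a = 1 \<longrightarrow> k \<le> 3 \<and> n \<le> 4) \<and> (a = 2 \<longrightarrow> k \<le> 6 \<and> n \<le> 56) \<and>
    (a = 3 \<longrightarrow> k \<le> 11 \<and> n \<le> 2024)"
proof -
  obtain t S y0 y1 where *: "three_valued_set k (2 * int t) S" "card S = n" "0 \<notin> S"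
    and t: "t dvd 2 ^ k" "\<not> 2 ^ a dvd t" and n: "n \<noteq> 2 * t"
    and y: "y0 \<in> word_space k" "y0 \<noteq> 0" "fourier k S y0 = 0"
    "y1 \<in> word_space k" "y1 \<noteq> 0" "fourier k S y1 = 2 * int t"
    using admissible_code_points[OF assms] .
  obtain s where s: "t = 2 ^ s"
    using t(1) by (auto simp: divides_primepow_nat two_is_prime_nat)
  have "s < a" using t(2) by (simp add: s le_imp_power_dvd) (meson le_imp_power_dvd not_le)
  have t124: "t \<in> {1, 2, 4} \<and> (a = 1 \<longrightarrow> t = 1) \<and> (a = 2 \<longrightarrow> t \<noteq> 4)" if "a \<in> {1, 2, 3}"
  proof -
    have "s = 0 \<or> s = 1 \<or> s = 2" using that \<open>s < a\<close> by auto
    then show ?thesis using \<open>s < a\<close> s by auto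
  qed
  then show ?thesis
    using parameter_bounds[OF *(1) _ *(3) _ y] *(2) n by auto
qed

section \<open>Codes from perfect coverings by triple sums\<close>

lemma fourier_cubed_eq_sum_triples:
  assumes "A \<subseteq> word_space k"
  shows "fourier k A y ^ 3 = (\<Sum>x\<in>word_space k. int (card (triples A x)) * chi k y x)"
proof -
  let ?s = "\<lambda>(a, b, c). a + b + c :: nat \<Rightarrow> bit"
  have fin: "finite A" using assms by (rule finite_subset_word_space)
  have "?s ` (A \<times> A \<times> A) \<subseteq> word_space k"
    using assms by (auto intro!: word_space_add)
  then have "fourier k A y ^ 3 =
    (\<Sum>x\<in>word_space k. \<Sum>p\<in>{p\<in>A\<times>A\<times>A. ?s p = x}. chi k y (?s p))"
    unfolding fourier_cubed using sum.group[of "A\<times>A\<times>A" "word_space k" ?s "\<lambda>p. chi k y (?s p)"] fin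
    by (simp add: split_beta)
  also have "\<dots> = (\<Sum>x\<in>word_space k. int (card (triples A x)) * chi k y x)"
  proof (rule sum.cong[OF refl])
    fix x
    have "{p\<in>A\<times>A\<times>A. ?s p = x} = triples A x" by (auto simp: triples_def)
    moreover have "(\<Sum>p\<in>triples A x. chi k y (?s p)) = (\<Sum>p\<in>triples A x. chi k y x)"
      by (rule sum.cong) (auto simp: triples_def)
    ultimately show "(\<Sum>p\<in>{p\<in>A\<times>A\<times>A. ?s p = x}. chi k y (?s p)) = int (card (triples A x)) * chi k y x"
      by simp
  qed
  finally show ?thesis .
qed

text \<open>
  The lower bounds \<open>3 d - 2\<close> on the set and \<open>6\<close> outside it add up to the number \<open>d\<^sup>3\<close> of all
  triples, so they are attained everywhere.
\<close>

lemma card_triples_perfect_cover: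
  assumes D: "D \<subseteq> word_space k"
    and cover: "\<And>x. x \<in> word_space k \<Longrightarrow> triples D x \<noteq> {}"
    and count: "card D ^ 3 = card D * (3 * card D - 2) + 6 * (2 ^ k - card D)"
    and x: "x \<in> word_space k"
  shows "card (triples D x) = (if x \<in> D then 3 * card D - 2 else 6)"
proof -
  have fin: "finite D" using D by (rule finite_subset_word_space)
  have "(\<Sum>x\<in>word_space k. if x \<in> D then 3 * card D - 2 else 6) = card D ^ 3"
    using D unfolding count
    by (subst sum.If_cases) (simp_all add: Int_absorb1 Diff_eq[symmetric] card_Diff_subset[OF fin])
  also have "\<dots> = (\<Sum>x\<in>word_space k. card (triples D x))"
    using sum_card_triples[OF D] by simp
  finally have "(if x \<in> D then 3 * card D - 2 else 6) = card (triples D x)"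
    by (rule sum_mono_inv) (use x cover fin in \<open>auto intro!: card_triples_ge card_triples_ge_6\<close>)
  then show ?thesis by simp
qed

text \<open>
  By the preceding count, the number of triples with a given sum is \<open>6\<close> plus \<open>4 t\<^sup>2\<close> times the indicator of
  \<open>D\<close>.  Its transform is the cube of that of \<open>D\<close>, and the constant contributes only at the origin;
  hence the transform is a root of \<open>F\<^sup>3 = 4 t\<^sup>2 F\<close>.
\<close>

lemma three_valued_perfect_cover:
  assumes D: "D \<subseteq> word_space k" "D \<noteq> {}" "card D < 2 ^ k"
    and cover: "\<And>x. x \<in> word_space k \<Longrightarrow> triples D x \<noteq> {}"
    and count: "card D ^ 3 = card D * (3 * card D - 2) + 6 * (2 ^ k - card D)"
    and t: "3 * card D = 8 + 4 * t\<^sup>2" "0 < t"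
  shows "three_valued_set k (2 * int t) D"
proof
  show "D \<noteq> word_space k" using D(3) by auto
  fix y :: "nat \<Rightarrow> bit" assume y: "y \<in> word_space k" "y \<noteq> 0"
  let ?F = "fourier k D y"
  have "?F ^ 3 = (\<Sum>x\<in>word_space k. 6 * chi k y x + (2 * int t)\<^sup>2 * (of_bool (x \<in> D) * chi k y x))"
    unfolding fourier_cubed_eq_sum_triples[OF D(1)]
  proof (intro sum.cong refl)
    fix x assume "x \<in> word_space k"
    then have c: "card (triples D x) = (if x \<in> D then 3 * card D - 2 else 6)"
      using card_triples_perfect_cover[OF D(1) cover count] by blast
    have "int (card (triples D x)) = 6 + (2 * int t)\<^sup>2 * of_bool (x \<in> D)"
      unfolding c using t(1) by (simp add: power_mult_distrib)
    then show "int (card (triples D x)) * chi k y x =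
      6 * chi k y x + (2 * int t)\<^sup>2 * (of_bool (x \<in> D) * chi k y x)"
      by (simp add: algebra_simps)
  qed
  also have "\<dots> = 6 * (\<Sum>x\<in>word_space k. chi k y x) +
      (2 * int t)\<^sup>2 * (\<Sum>x\<in>word_space k. of_bool (x \<in> D) * chi k y x)"
    by (simp only: sum.distrib sum_distrib_left)
  also have "(\<Sum>x\<in>word_space k. of_bool (x \<in> D) * chi k y x) = ?F"
    unfolding fourier_def using D(1) by (intro sum.mono_neutral_cong_right) auto
  finally have "?F * ((?F - 2 * int t) * (?F + 2 * int t)) = 0"
    using sum_chi[OF y(1)] y(2) by (simp add: algebra_simps power2_eq_square power3_eq_cube)
  then show "?F \<in> {0, 2 * int t, - (2 * int t)}" by auto
qed (use assms in auto)

context three_valued_set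
begin

lemma sum_fourier_nonzero:
  assumes "0 \<in> A"
  shows "(\<Sum>y\<in>word_space k - {0}. fourier k A y) = 2 ^ k - int (card A)"
  using fourier_inversion[OF subset word_space_0] assms by (simp add: sum_split_0)

text \<open>
  Inversion at the origin determines the difference of the two frequencies, Parseval's identity their
  sum.
\<close>

lemma value_distribution:
  assumes "0 \<in> A"
    and p: "u * (p - m) = 2 ^ k - int (card A)" "u * (p + m) = int (card A) * (p - m)"
  shows "int (card {y \<in> word_space k - {0}. fourier k A y = u}) = p"
    and "int (card {y \<in> word_space k - {0}. fourier k A y = - u}) = m"
proof -
  let ?P = "{y \<in> word_space k - {0}. fourier k A y = u}"
  let ?M = "{y \<in> word_space k - {0}. fourier k A y = - u}"
  have "(\<Sum>y\<in>word_space k - {0}. fourier k A y) =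
      (\<Sum>y\<in>word_space k - {0}. u * (of_bool (y \<in> ?P) - of_bool (y \<in> ?M)))"
    by (intro sum.cong refl) (use three_values u_pos in fastforce)
  also have "\<dots> = u * (int (card ?P) - int (card ?M))"
    by (simp add: sum_subtractf Int_def flip: sum_distrib_left)
  finally have "u * (int (card ?P) - int (card ?M)) = u * (p - m)"
    unfolding p(1) sum_fourier_nonzero[OF assms(1)] ..
  then have diff: "int (card ?P) - int (card ?M) = p - m" using u_pos by simp
  have "{y \<in> word_space k - {0}. fourier k A y \<noteq> 0} = ?P \<union> ?M"
    using three_values u_pos by force
  moreover have "card (?P \<union> ?M) = card ?P + card ?M"
    using u_pos by (intro card_Un_disjoint) auto
  ultimately have "u\<^sup>2 * (int (card ?P) + int (card ?M)) = int (card A) * (2 ^ k - int (card A))"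
    using parseval by (simp add: algebra_simps power2_eq_square)
  also have "\<dots> = u\<^sup>2 * (p + m)"
    unfolding p(1)[symmetric] power2_eq_square using p(2) by (simp add: mult.assoc mult.left_commute)
  finally have "int (card ?P) + int (card ?M) = p + m" using u_pos by simp
  then show "int (card ?P) = p" "int (card ?M) = m" using diff by linarith+
qed

end

text \<open>
  The code has the complement of \<open>D\<close> as its columns.  The number \<open>m\<close> counts the points \<open>y\<close> at which the
  transform of \<open>D\<close> equals \<open>-2t\<close>, and \<open>r + m\<close> those at which it equals \<open>2t\<close>; the last three numerical
  hypotheses guarantee that all three weights are positive and occur.
\<close>

theorem admissible_code_of_perfect_cover:
  assumes D: "D \<subseteq> word_space k" "0 \<in> D"
    and cover: "\<And>x. x \<in> word_space k \<Longrightarrow> triples D x \<noteq> {}"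
    and count: "card D ^ 3 = card D * (3 * card D - 2) + 6 * (2 ^ k - card D)"
    and t: "3 * card D = 8 + 4 * t\<^sup>2" "0 < t" "\<not> 2 ^ a dvd t"
    and p: "card D + 2 * t * r = 2 ^ k" "2 * t * (r + 2 * m) = card D * r" "1 < r" "0 < m"
      "r + 2 * m + 1 < 2 ^ k"
  shows "\<exists>C. admissible_code a (2 ^ k - card D) k C"
proof -
  define n where "n = 2 ^ k - card D"
  define h where "h = t * r"
  have n: "n = 2 * h" unfolding n_def h_def p(1)[symmetric] by simp
  have "t * 2 \<le> t * r" using p(3) by (intro mult_le_mono2) simp
  then have h: "t < h" using t(2) by (simp add: h_def)
  interpret three_valued_set k "2 * int t" D
    by (rule three_valued_perfect_cover[OF D(1) _ _ cover count t(1,2)])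
      (use D h n in \<open>auto simp: n_def\<close>)
  define F where "F = fourier k D"
  have eq1: "2 * int t * (int (r + m) - int m) = 2 ^ k - int (card D)"
    using arg_cong[OF p(1), of int] by (simp add: algebra_simps)
  have eq2: "2 * int t * (int (r + m) + int m) = int (card D) * (int (r + m) - int m)"
    using arg_cong[OF p(2), of int] by (simp add: algebra_simps)
  let ?W = "word_space k - {0}"
  have P: "card {y \<in> ?W. F y = 2 * int t} = r + m" and M: "card {y \<in> ?W. F y = - (2 * int t)} = m"
    using value_distribution[OF D(2) eq1 eq2] unfolding F_def of_nat_eq_iff by auto
  have "{y \<in> ?W. F y = 2 * int t} \<noteq> {}" using P p(3) by (metis card.empty add_is_0 not_one_less_zero)
  then obtain y1 where y1: "y1 \<in> ?W" "F y1 = 2 * int t" by blast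
  have "{y \<in> ?W. F y = - (2 * int t)} \<noteq> {}" using M p(4) by (metis card.empty less_irrefl)
  then obtain y2 where y2: "y2 \<in> ?W" "F y2 = - (2 * int t)" by blast
  have "\<exists>y\<in>?W. F y = 0"
  proof (rule ccontr)
    assume no_zero: "\<not> (\<exists>y\<in>?W. F y = 0)"
    have "?W \<subseteq> {y \<in> ?W. F y = 2 * int t} \<union> {y \<in> ?W. F y = - (2 * int t)}"
    proof
      fix y assume y: "y \<in> ?W"
      then have "F y \<in> {0, 2 * int t, - (2 * int t)}" using three_values by (simp add: F_def)
      then show "y \<in> {y \<in> ?W. F y = 2 * int t} \<union> {y \<in> ?W. F y = - (2 * int t)}"
        using y no_zero by blast
    qed
    then have "card ?W \<le> card ({y \<in> ?W. F y = 2 * int t} \<union> {y \<in> ?W. F y = - (2 * int t)})"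
      by (intro card_mono) auto
    also have "\<dots> \<le> r + m + m"
      using card_Un_le[of "{y \<in> ?W. F y = 2 * int t}" "{y \<in> ?W. F y = - (2 * int t)}"]
      unfolding P M .
    finally show False using p(5) by (simp add: card_Diff_subset)
  qed
  then obtain y0 where y0: "y0 \<in> ?W" "F y0 = 0" by blast
  define S where "S = word_space k - D"
  have S: "S \<subseteq> ?W" "card S = n"
    using D by (auto simp: S_def n_def card_Diff_subset finite_points)
  have w: "2 * int (point_weight k S y) = int n + F y" if "y \<in> ?W" for y
    using fourier_eq_point_weight[of S k y] fourier_complement[OF D(1), of y] that S(2)
    by (simp add: S_def F_def)
  have weights: "point_weight k S y \<in> {h - t, h, h + t}" if "y \<in> ?W" for y
    using w[OF that] three_values[of y] that n h unfolding F_def by auto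
  have "point_weight k S y \<noteq> 0" if "y \<in> word_space k" "y \<noteq> 0" for y
    using weights[of y] that h by auto
  then obtain C where C: "linear_code n k C" "projective n C"
    "nonzero_weights n C = point_weight k S ` ?W"
    using projective_code_of_points[OF S(1)] S(2) by metis
  have "point_weight k S y0 = h" "point_weight k S y1 = h + t" "point_weight k S y2 = h - t"
    using w[OF y0(1)] w[OF y1(1)] w[OF y2(1)] y0(2) y1(2) y2(2) n h by auto
  then have "{h - t, h, h + t} \<subseteq> point_weight k S ` ?W"
    using y0(1) y1(1) y2(1) by (metis empty_subsetI image_eqI insert_subset)
  then have W: "nonzero_weights n C = {h - t, h, h + t}"
    using C(3) weights by auto
  have "\<not> divisible_code (2 ^ a) n C"
  proof
    assume div: "divisible_code (2 ^ a) n C"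
    have "2 ^ a dvd v" if "v \<in> nonzero_weights n C" for v
      using that div by (auto simp: nonzero_weights_def divisible_code_def)
    then have "2 ^ a dvd h" "2 ^ a dvd h + t" using W by auto
    then show False using t(3) by (simp add: dvd_add_right_iff)
  qed
  moreover have "h - t < h" "h < h + t" "real (h - t) + real h + real (h + t) = 3 * real n / 2"
    "real h = real n / 2"
    using h t(2) n by (auto simp: of_nat_diff)
  ultimately have "admissible_code a n k C"
    unfolding admissible_code_def using C(1,2) W by blast
  then show ?thesis unfolding n_def by blast
qed

section \<open>The perfect three-error-correcting codes\<close>

text \<open>
  The covering property of the three sets is verified by evaluation.  Vectors become lists of
  truth values, on which addition is defined by constructor patterns so that it rewrites quickly.
\<close>

fun vec :: "bool list \<Rightarrow> nat \<Rightarrow> bit" where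
  "vec [] i = 0"
| "vec (b # v) 0 = of_bool b"
| "vec (b # v) (Suc i) = vec v i"

fun vxor :: "bool list \<Rightarrow> bool list \<Rightarrow> bool list" where
  "vxor (True # u) (b # v) = (\<not> b) # vxor u v"
| "vxor (False # u) (b # v) = b # vxor u v"
| "vxor u v = []"

fun pair_sums :: "bool list list \<Rightarrow> bool list list" where
  "pair_sums [] = []"
| "pair_sums (v # vs) = map (vxor v) vs @ pair_sums vs"

fun triple_sums :: "bool list list \<Rightarrow> bool list list" where
  "triple_sums [] = []"
| "triple_sums (v # vs) = map (vxor v) (pair_sums vs) @ triple_sums vs"

text \<open>
  That a list of vectors exhausts the space is decided by repeatedly splitting it according to
  the first coordinate, which avoids comparing every vector with every sum.
\<close>

fun tails :: "bool \<Rightarrow> bool list list \<Rightarrow> bool list list" where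
  "tails b [] = []"
| "tails True ((True # v) # L) = v # tails True L"
| "tails False ((False # v) # L) = v # tails False L"
| "tails b (_ # L) = tails b L"

fun covers :: "nat \<Rightarrow> bool list list \<Rightarrow> bool" where
  "covers 0 L = (L \<noteq> [])"
| "covers (Suc k) L = (covers k (tails True L) \<and> covers k (tails False L))"

text \<open>
  A monic polynomial \<open>g\<close> of degree \<open>k\<close> is given by its \<open>k\<close> lower coefficients, constant term first, and
  \<open>mul_x\<close> is multiplication by \<open>x\<close> modulo \<open>g\<close>.  If \<open>g\<close> divides \<open>x\<^sup>l - 1\<close>, then the residues of
  \<open>1, x, \<dots>, x\<^sup>l\<^sup>-\<^sup>1\<close> are the columns of a parity check matrix of the cyclic code of length \<open>l\<close>
  generated by \<open>g\<close>; the zero vector is put in front of them.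
\<close>

definition mul_x :: "bool list \<Rightarrow> bool list \<Rightarrow> bool list" where
  "mul_x g v = (if last v then vxor g (False # butlast v) else False # butlast v)"

fun powers_x :: "bool list \<Rightarrow> nat \<Rightarrow> bool list \<Rightarrow> bool list list" where
  "powers_x g 0 v = []"
| "powers_x g (Suc n) v = v # powers_x g n (mul_x g v)"

definition check_columns :: "bool list \<Rightarrow> nat \<Rightarrow> bool list list" where
  "check_columns g l =
    map (\<lambda>_. False) g # powers_x g l (True # map (\<lambda>_. False) (tl g))"

lemma vec_in_word_space: "vec v \<in> word_space (length v)"
  unfolding word_space_def
proof clarsimp
  show "length v \<le> i \<Longrightarrow> vec v i = 0" for i
    by (induction v i rule: vec.induct) auto
qed

lemma vec_False: "vec (map (\<lambda>_. False) v) = 0"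
proof
  show "vec (map (\<lambda>_. False) v) i = 0 i" for i
  proof (induction v arbitrary: i)
    case (Cons b v)
    then show ?case by (cases i) auto
  qed simp
qed

lemma length_vxor: "length u = length v \<Longrightarrow> length (vxor u v) = length v"
  by (induction u v rule: vxor.induct) auto

lemma vec_vxor: "length u = length v \<Longrightarrow> vec (vxor u v) = vec u + vec v"
proof
  show "length u = length v \<Longrightarrow> vec (vxor u v) i = (vec u + vec v) i" for i
  proof (induction u v arbitrary: i rule: list_induct2)
    case (Cons a u b v)
    then show ?case by (cases a; cases i) auto
  qed simp
qed

lemma vec_inject: "length u = length v \<Longrightarrow> vec u = vec v \<Longrightarrow> u = v"
proof (induction u v rule: list_induct2)
  case (Cons a u b v)
  have "vec u i = vec v i" for i
    using fun_cong[OF Cons.prems, of "Suc i"] by simp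
  then have "u = v" by (intro Cons.IH ext)
  moreover have "a = b" using fun_cong[OF Cons.prems, of 0] by (cases a; cases b) auto
  ultimately show ?case by simp
qed simp

lemma set_tails: "v \<in> set (tails b L) \<longleftrightarrow> b # v \<in> set L"
  by (induction b L rule: tails.induct) auto

lemma covers_sound:
  assumes "covers k L" "x \<in> word_space k" "\<forall>v\<in>set L. length v = k"
  shows "x \<in> vec ` set L"
  using assms
proof (induction k arbitrary: L x)
  case 0
  then obtain v where "v \<in> set L" by (cases L) auto
  then have "v = []" using 0 by auto
  moreover have "x = vec []" using 0 by (auto simp: word_space_def)
  ultimately show ?case using \<open>v \<in> set L\<close> by blast
next
  case (Suc k)
  define b where "b = (x 0 = 1)"
  have "covers k (tails b L)" using Suc.prems(1) by (cases b) auto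
  moreover have "(\<lambda>i. x (Suc i)) \<in> word_space k" using Suc.prems(2) by (simp add: word_space_def)
  moreover have "\<forall>v\<in>set (tails b L). length v = k"
    using Suc.prems(3) by (fastforce simp: set_tails)
  ultimately obtain v where v: "v \<in> set (tails b L)" "(\<lambda>i. x (Suc i)) = vec v"
    using Suc.IH by blast
  have "x i = vec (b # v) i" for i
    using fun_cong[OF v(2), of "i - 1"] by (cases i) (auto simp: b_def)
  then have "x = vec (b # v)" by (rule ext)
  then show ?case using v(1) by (auto simp: set_tails)
qed

lemma set_pair_sums: "s \<in> set (pair_sums L) \<Longrightarrow> \<exists>u\<in>set L. \<exists>v\<in>set L. s = vxor u v"
  by (induction L) auto

lemma set_triple_sums:
  "s \<in> set (triple_sums L) \<Longrightarrow> \<exists>u\<in>set L. \<exists>v\<in>set L. \<exists>w\<in>set L. s = vxor u (vxor v w)"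
proof (induction L)
  case (Cons u L)
  then consider "s \<in> set (triple_sums L)" | r where "r \<in> set (pair_sums L)" "s = vxor u r" by auto
  then show ?case
  proof cases
    case 1
    then show ?thesis using Cons.IH by (meson list.set_intros(2))
  next
    case 2
    then show ?thesis using set_pair_sums by (metis list.set_intros)
  qed
qed simp

lemma triple_sums_sound:
  assumes L: "\<forall>v\<in>set L. length v = k" and s: "s \<in> set (triple_sums L)"
  shows "length s = k \<and> (\<exists>u\<in>set L. \<exists>v\<in>set L. \<exists>w\<in>set L. vec s = vec u + vec v + vec w)"
proof -
  obtain u v w where uvw: "u \<in> set L" "v \<in> set L" "w \<in> set L" "s = vxor u (vxor v w)"
    using set_triple_sums[OF s] by blast
  then have "length s = k" "vec s = vec u + vec v + vec w"
    using L by (simp_all only: length_vxor vec_vxor add.assoc)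
  then show ?thesis using uvw by blast
qed

definition perfect_cover_check :: "bool list list \<Rightarrow> nat \<Rightarrow> bool" where
  "perfect_cover_check L k \<longleftrightarrow>
    list_all (\<lambda>v. length v = k) L \<and> distinct L \<and> covers k (L @ triple_sums L)"

lemma perfect_cover_check_sound:
  assumes "perfect_cover_check L k"
  shows "vec ` set L \<subseteq> word_space k" "card (vec ` set L) = length L"
    "x \<in> word_space k \<Longrightarrow> triples (vec ` set L) x \<noteq> {}"
proof -
  have L: "\<forall>v\<in>set L. length v = k" "distinct L" "covers k (L @ triple_sums L)"
    using assms by (auto simp: perfect_cover_check_def list_all_iff)
  show "vec ` set L \<subseteq> word_space k" using L(1) vec_in_word_space by fastforce
  have "inj_on vec (set L)" using L(1) vec_inject by (simp add: inj_on_def)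
  then show "card (vec ` set L) = length L" using L(2) by (simp add: card_image distinct_card)
  assume x: "x \<in> word_space k"
  have "\<forall>v\<in>set (L @ triple_sums L). length v = k"
    using L(1) triple_sums_sound[OF L(1)] by auto
  then obtain s where s: "s \<in> set L \<union> set (triple_sums L)" "x = vec s"
    using covers_sound[OF L(3) x] by auto
  show "triples (vec ` set L) x \<noteq> {}"
  proof (cases "s \<in> set L")
    case True
    then have "(x, x, x) \<in> triples (vec ` set L) x" using s(2) by (simp add: triples_def)
    then show ?thesis by blast
  next
    case False
    then obtain u v w where "u \<in> set L" "v \<in> set L" "w \<in> set L" "x = vec u + vec v + vec w"
      using triple_sums_sound[OF L(1)] s by blast
    then have "(vec u, vec v, vec w) \<in> triples (vec ` set L) x" by (simp add: triples_def)
    then show ?thesis by blast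
  qed
qed

lemma admissible_code_of_check_columns:
  assumes check: "perfect_cover_check (check_columns g l) k"
    and d: "length (check_columns g l) = d"
    and eqs: "d ^ 3 = d * (3 * d - 2) + 6 * (2 ^ k - d)" "3 * d = 8 + 4 * t\<^sup>2" "0 < t" "\<not> 2 ^ a dvd t"
      "d + 2 * t * r = 2 ^ k" "2 * t * (r + 2 * m) = d * r" "1 < r" "0 < m" "r + 2 * m + 1 < 2 ^ k"
  shows "\<exists>C. admissible_code a (2 ^ k - d) k C"
proof -
  let ?L = "check_columns g l"
  note s = perfect_cover_check_sound[OF check]
  have "map (\<lambda>_. False) g \<in> set ?L" by (simp add: check_columns_def)
  then have 0: "0 \<in> vec ` set ?L" using vec_False by (metis image_eqI)
  show ?thesis
    using admissible_code_of_perfect_cover[OF s(1) 0 s(3), of t a r m, unfolded s(2) d] eqs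
    by simp
qed

text \<open>
  The polynomial \<open>1 + x\<^sup>2 + x\<^sup>4 + x\<^sup>5 + x\<^sup>6 + x\<^sup>1\<^sup>0 + x\<^sup>1\<^sup>1\<close>, a factor of \<open>x\<^sup>2\<^sup>3 - 1\<close>.
\<close>

definition golay_generator :: "bool list" where
  "golay_generator = [True, False, True, False, True, True, True, False, False, False, True]"

text \<open>
  The first two polynomials are \<open>x\<^sup>3 + 1\<close> and \<open>1 + x + \<dots> + x\<^sup>6\<close>, which generate the zero code of
  length 3 and the repetition code of length 7.
\<close>

lemma perfect_checks:
  "perfect_cover_check (check_columns [True, False, False] 3) 3"
  "perfect_cover_check (check_columns [True, True, True, True, True, True] 7) 6"
  "perfect_cover_check (check_columns golay_generator 23) 11"
  by code_simp+

lemma length_check_columns: "length (check_columns g l) = Suc l"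
proof -
  have "length (powers_x g l v) = l" for v
    by (induction l arbitrary: v) auto
  then show ?thesis by (simp add: check_columns_def)
qed

text \<open>
  The values of \<open>r\<close> and \<open>m\<close> solve the equations for the frequencies; for the Golay code, \<open>506\<close> and \<open>253\<close>
  are the numbers of words of weight 8 and 16 in its even-weight subcode.
\<close>

lemma extremal_codes:
  shows "\<exists>C. admissible_code 1 4 3 C" "\<exists>C. admissible_code 2 56 6 C"
    "\<exists>C. admissible_code 3 2024 11 C"
proof -
  have "\<exists>C. admissible_code 1 (2 ^ 3 - 4) 3 C"
    by (rule admissible_code_of_check_columns[OF perfect_checks(1), where t = 1 and r = 2 and m = 1])
      (simp_all add: length_check_columns)
  then show "\<exists>C. admissible_code 1 4 3 C" by simp
  have "\<exists>C. admissible_code 2 (2 ^ 6 - 8) 6 C"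
    by (rule admissible_code_of_check_columns[OF perfect_checks(2), where t = 2 and r = 14 and m = 7])
      (simp_all add: length_check_columns)
  then show "\<exists>C. admissible_code 2 56 6 C" by simp
  have "\<exists>C. admissible_code 3 (2 ^ 11 - 24) 11 C"
    by (rule admissible_code_of_check_columns[OF perfect_checks(3), where t = 4 and r = 253 and m = 253])
      (simp_all add: length_check_columns)
  then show "\<exists>C. admissible_code 3 2024 11 C" by simp
qed

theorem theorem5p14:
  shows "(is_K 1 3 \<and> is_N 1 4) \<and>
         (is_K 2 6 \<and> is_N 2 56) \<and>
         (is_K 3 11 \<and> is_N 3 2024)"
  unfolding is_K_def is_N_def is_maximum_def
  by (intro conjI CollectI ballI; (elim CollectE exE)?)
    (use extremal_codes in blast | (drule admissible_code_bounds, simp))+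

end
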